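(* Let $K$ be a field of characteristic $0$, let $n\ge1$, $r\ge1$ and $0\le m\le n-1$ be integers. In $K[x_0,\dots,x_n]$ put $$h_i'=x_0^r\cdots\widehat{x_i^r}\cdots x_n^r\ (0\le i\le n),\qquad f_1'=\sum_{i=m+1}^n h_i',\qquad f_2'=\sum_{i=0}^m h_i'.$$ (i) The divisor in $\mathbb{P}^n$ defined by $$(f_1'f_2')^{\mathrm{red}}=x_0\cdots x_n\left(\sum_{i=0}^m x_0^r\cdots\widehat{x_i^r}\cdots x_m^r\right)\left(\sum_{i=m+1}^n x_{m+1}^r\cdots\widehat{x_i^r}\cdots x_n^r\right)$$ is free with exponents $(1,r+1,\dots,r+1)$ (with $r+1$ repeated $n-1$ times). (ii) Let $k\ge3$ and let $[a_i;b_i]\in\mathbb{P}^1$, $3\le i\le k$, be such that the hypersurfaces $V(a_if_1'+b_if_2')$ are generic members of the pencil $C(f_1',f_2')$. Then the divisor in $\mathbb{P}^n$ defined by $$(f_1'f_2')^{\mathrm{red}}\prod_{i=3}^k(a_if_1'+b_if_2')$$ is free with exponents $(r+1,\dots,r+1,\ rn(k-2)+1)$ (with $r+1$ repeated $n-1$ times).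
   Context: A hat means the factor is omitted; empty products equal $1$. For a polynomial $f$, $f^{\mathrm{red}}$ is its reduced polynomial, i.e. the product of its distinct irreducible factors. The pencil $C(f_1',f_2')$ is the family of hypersurfaces $V(af_1'+bf_2')$, $[a;b]\in\mathbb{P}^1$. "Generic members" means that the statement holds for $([a_3;b_3],\dots,[a_k;b_k])$ in some non-empty Zariski-open subset of $(\mathbb{P}^1)^{k-2}$ (in particular the members are pairwise distinct with all $a_i,b_i$ non-zero). For a reduced homogeneous $f\in R=K[x_0,\dots,x_n]$ (standard grading), $\mathrm{Der}_0(f)=\{\delta\in\mathrm{Der}_K(R):\delta(f)=0\}$; a derivation is homogeneous of degree $a$ if all its coefficients on the $\partial_{x_i}$ are homogeneous of degree $a$ (or zero). $V(f)\subset\mathbb{P}^n$ is free with exponents $(a_1,\dots,a_n)$ if $\mathrm{Der}_0(f)$ is a free $R$-module with a basis of $n$ homogeneous derivations of degrees $a_1,\dots,a_n$ (in any order). *)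

theory Defs
  imports
    "HOL-Library.Poly_Mapping"
    "HOL-Library.FuncSet"
    "HOL-Computational_Algebra.Squarefree"
begin

section \<open>Polynomials\<close>

type_synonym ('v, 'k) mpol = "('v \<Rightarrow>\<^sub>0 nat) \<Rightarrow>\<^sub>0 'k"

definition cst :: "'k \<Rightarrow> ('v, 'k::zero) mpol" where
  "cst c = Poly_Mapping.single 0 c"

definition X :: "'v \<Rightarrow> ('v, 'k::zero_neq_one) mpol" where
  "X v = Poly_Mapping.single (Poly_Mapping.single v 1) 1"

definition eval_mpol :: "('v, 'k::comm_semiring_1) mpol \<Rightarrow> ('v \<Rightarrow> 'k) \<Rightarrow> 'k" where
  "eval_mpol p x =
     (\<Sum>t\<in>Poly_Mapping.keys p. Poly_Mapping.lookup p t *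
        (\<Prod>v\<in>Poly_Mapping.keys t. x v ^ Poly_Mapping.lookup t v))"

text \<open>
  The ring $R = K[x_0,\dots,x_n]$ is realised inside the polynomial ring over $K$ in the
  variables $x_0, x_1, x_2, \dots$.  Every divisor of a non-zero element of $R$ in the
  big ring lies in $R$, and the units of both rings are the non-zero constants; hence
  divisibility, irreducibility and squarefreeness of a non-zero element of $R$
  mean the same in both rings, and the library notions are used for the big ring.
\<close>

definition R :: "nat \<Rightarrow> (nat, 'k::zero) mpol set" where
  "R n = {p. \<forall>t\<in>Poly_Mapping.keys p. Poly_Mapping.keys t \<subseteq> {0..n}}"

text \<open>The zero polynomial is homogeneous of every degree.\<close>

definition homogeneous :: "nat \<Rightarrow> ('v, 'k::zero) mpol \<Rightarrow> bool" where
  "homogeneous d p \<longleftrightarrow>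
     (\<forall>t\<in>Poly_Mapping.keys p. (\<Sum>v\<in>Poly_Mapping.keys t. Poly_Mapping.lookup t v) = d)"

text \<open>
  \<open>is_reduced_of f g\<close>: \<open>g\<close> is (a representative of) the reduced polynomial of \<open>f\<close>.
  Irreducible factors are only determined up to units, so \<open>P\<close> picks exactly one irreducible
  factor of \<open>f\<close> from each class of associates, and \<open>g\<close> is determined up to a non-zero constant.
\<close>

definition is_reduced_of :: "(nat, 'k::field) mpol \<Rightarrow> (nat, 'k) mpol \<Rightarrow> bool" where
  "is_reduced_of f g \<longleftrightarrow>
     (\<exists>P c. finite P \<and> (\<forall>p\<in>P. irreducible p \<and> p dvd f) \<and>
        (\<forall>q. irreducible q \<and> q dvd f \<longrightarrow> (\<exists>!p. p \<in> P \<and> p dvd q \<and> q dvd p)) \<and>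
        c \<noteq> 0 \<and> g = cst c * (\<Prod>p\<in>P. p))"


section \<open>Derivations and free divisors\<close>

text \<open>
  Derivations are functions on the big polynomial ring of which only the restriction
  to \<open>R n\<close> matters.
\<close>

definition Der :: "nat \<Rightarrow> ((nat, 'k::field) mpol \<Rightarrow> (nat, 'k) mpol) set" where
  "Der n = {\<delta>. \<delta> \<in> R n \<rightarrow> R n \<and>
     (\<forall>p\<in>R n. \<forall>q\<in>R n. \<delta> (p + q) = \<delta> p + \<delta> q) \<and>
     (\<forall>c. \<forall>p\<in>R n. \<delta> (cst c * p) = cst c * \<delta> p) \<and>
     (\<forall>p\<in>R n. \<forall>q\<in>R n. \<delta> (p * q) = p * \<delta> q + q * \<delta> p)}"

definition Der0 ::
  "nat \<Rightarrow> (nat, 'k::field) mpol \<Rightarrow> ((nat, 'k) mpol \<Rightarrow> (nat, 'k) mpol) set" where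
  "Der0 n f = {\<delta> \<in> Der n. \<delta> f = 0}"

text \<open>The coefficient of \<open>\<delta>\<close> on $\partial_{x_i}$ is $\delta(x_i)$.\<close>

definition homogeneous_der ::
  "nat \<Rightarrow> nat \<Rightarrow> ((nat, 'k::field) mpol \<Rightarrow> (nat, 'k) mpol) \<Rightarrow> bool" where
  "homogeneous_der n a \<delta> \<longleftrightarrow> (\<forall>i\<in>{0..n}. homogeneous a (\<delta> (X i)))"

text \<open>
  \<open>\<theta> 0, \<dots>, \<theta> (N - 1)\<close> is a basis of the \<open>R n\<close>-module \<open>M\<close> of maps on \<open>R n\<close>: every
  element of \<open>M\<close> is a linear combination of them with uniquely determined coefficients.
\<close>

definition is_basis ::
  "nat \<Rightarrow> ((nat, 'k::field) mpol \<Rightarrow> (nat, 'k) mpol) set \<Rightarrow> nat \<Rightarrow>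
   (nat \<Rightarrow> (nat, 'k) mpol \<Rightarrow> (nat, 'k) mpol) \<Rightarrow> bool" where
  "is_basis n M N \<theta> \<longleftrightarrow>
     (\<forall>j<N. \<theta> j \<in> M) \<and>
     (\<forall>\<delta>\<in>M. \<exists>!c. c \<in> {..<N} \<rightarrow>\<^sub>E R n \<and> (\<forall>p\<in>R n. \<delta> p = (\<Sum>j<N. c j * \<theta> j p)))"

text \<open>
  Freeness is only defined for reduced homogeneous polynomials, so these conditions are part
  of the predicate.  As the basis may be enumerated in any way, the order of the
  exponents in \<open>es\<close> is irrelevant.
\<close>

definition free_with_exponents :: "nat \<Rightarrow> (nat, 'k::field) mpol \<Rightarrow> nat list \<Rightarrow> bool" where
  "free_with_exponents n f es \<longleftrightarrow>
     f \<in> R n \<and> (\<exists>d. homogeneous d f) \<and> squarefree f \<and>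
     length es = n \<and>
     (\<exists>\<theta>. is_basis n (Der0 n f) n \<theta> \<and> (\<forall>j<n. homogeneous_der n (es ! j) (\<theta> j)))"


section \<open>Zariski-open subsets of products of projective lines\<close>

text \<open>For \<open>(a, b) \<noteq> (0, 0)\<close>, the point $[a;b]$ is the set of all its homogeneous coordinates.\<close>

definition proj_pt :: "'k::field \<Rightarrow> 'k \<Rightarrow> ('k \<times> 'k) set" where
  "proj_pt a b = {(s * a, s * b) | s. s \<noteq> 0}"

definition P1 :: "('k::field \<times> 'k) set set" where
  "P1 = {proj_pt a b | a b. (a, b) \<noteq> (0, 0)}"

text \<open>
  Polynomials in the coordinates \<open>Inl i\<close>, \<open>Inr i\<close> (first and second coordinate on
  the \<open>i\<close>-th factor) that are homogeneous in each of these pairs.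
\<close>

definition multihomogeneous :: "nat set \<Rightarrow> (nat + nat, 'k::zero) mpol \<Rightarrow> bool" where
  "multihomogeneous I F \<longleftrightarrow>
     (\<forall>t\<in>Poly_Mapping.keys F. Poly_Mapping.keys t \<subseteq> Inl ` I \<union> Inr ` I) \<and>
     (\<exists>d. \<forall>t\<in>Poly_Mapping.keys F. \<forall>i\<in>I.
        Poly_Mapping.lookup t (Inl i) + Poly_Mapping.lookup t (Inr i) = d i)"

definition zero_locus ::
  "nat set \<Rightarrow> (nat + nat, 'k::field) mpol set \<Rightarrow> (nat \<Rightarrow> ('k \<times> 'k) set) set" where
  "zero_locus I S = {P \<in> I \<rightarrow>\<^sub>E P1.
     \<forall>F\<in>S. \<forall>x. (\<forall>i\<in>I. x i \<in> P i) \<longrightarrow>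
       eval_mpol F (case_sum (\<lambda>i. fst (x i)) (\<lambda>i. snd (x i))) = 0}"

definition zariski_open :: "nat set \<Rightarrow> (nat \<Rightarrow> ('k::field \<times> 'k) set) set \<Rightarrow> bool" where
  "zariski_open I U \<longleftrightarrow>
     (\<exists>S. (\<forall>F\<in>S. multihomogeneous I F) \<and> U = (I \<rightarrow>\<^sub>E P1) - zero_locus I S)"


section \<open>The pencil\<close>

definition omit_prod :: "nat \<Rightarrow> nat set \<Rightarrow> nat \<Rightarrow> (nat, 'k::field) mpol" where
  "omit_prod r A i = (\<Prod>j\<in>A - {i}. X j ^ r)"

definition f1 :: "nat \<Rightarrow> nat \<Rightarrow> nat \<Rightarrow> (nat, 'k::field) mpol" where
  "f1 n r m = (\<Sum>i=m+1..n. omit_prod r {0..n} i)"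

definition f2 :: "nat \<Rightarrow> nat \<Rightarrow> nat \<Rightarrow> (nat, 'k::field) mpol" where
  "f2 n r m = (\<Sum>i=0..m. omit_prod r {0..n} i)"

definition f12_red :: "nat \<Rightarrow> nat \<Rightarrow> nat \<Rightarrow> (nat, 'k::field) mpol" where
  "f12_red n r m =
     (\<Prod>i=0..n. X i) * (\<Sum>i=0..m. omit_prod r {0..m} i) * (\<Sum>i=m+1..n. omit_prod r {m+1..n} i)"

end

theory Submission
  imports Defs "HOL-Computational_Algebra.Polynomial"
begin

text \<open>
  Put $y_i = x_i^{-r}$. Up to a common monomial factor, $f_1'$ and $f_2'$ are the sums of the $y_i$ with
  $i > m$ and $i \le m$, and $x_i\,\partial_{x_i}$ multiplies $y_i$ by $-r$. A derivation that
  is logarithmic along $x_0 \cdots x_n$ has the form $\sum_i g_i x_i \partial_{x_i}$. Let $p$ and $q$ be the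
  last two factors of $(f_1'f_2')^{\mathrm{red}}$. Being logarithmic along $p$ and $q$ forces
  $g_i = \alpha + c_i x_i^r$ for $i \le m$ and $g_i = \beta + c_i x_i^r$ for $i > m$, where the $c_i$ of
  each block sum to zero; being logarithmic along the members $L_i$ of the pencil forces
  $\beta - \alpha = H \prod_i L_i$. Annihilating the whole product is then one equation, in which
  $\alpha$ has a non-zero constant coefficient. So $H$ and $n - 1$ of the $c_i$ are free parameters, and
  their degrees give the exponents. Part (i) is the case of no $L_i$.

  All this needs is that the factors are pairwise coprime and squarefree, which holds as soon as the
  chosen points are pairwise distinct with non-zero coordinates.
\<close>


section \<open>Subrings generated by sets of variables\<close>

text \<open>If a derivation \<delta> kills \<open>s * w\<close> and \<open>s\<close>,
  \<open>w\<close> are coprime, then \<open>s\<close> divides \<open>w * \<delta> s\<close>, hence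
  \<delta> s. This is how killing a product becomes a condition on each factor, and it rests on
  unique factorisation. In infinitely many variables that is reached by adjoining one variable at a
  time, as each polynomial involves finitely many of them. A factor along which the derivation is
  logarithmic is an eigenvector, and eigenvalues add over products; so killing the whole product is
  one linear equation. Its coefficient at \<alpha> is the degree of the product, because the Euler
  derivation is the case \<alpha> = \<beta> = 1, H = 0 and all c_i = 0. Characteristic 0 makes this
  degree invertible, so \<alpha> is determined by the other data. A parameter c_i enters through c_i
  x_i^r, and H through H times the product of the L_i, which has degree r n (k - 2). The coefficient
  at the i-th partial derivative is g_i x_i, which raises either degree by 1.\<close>

definition polys_in :: "'v set \<Rightarrow> ('v, 'k::zero) mpol set" where
  "polys_in V = {p. \<forall>t\<in>Poly_Mapping.keys p. Poly_Mapping.keys t \<subseteq> V}"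

text \<open>Other sets of variables serve two purposes: unique factorisation is proved by adjoining
  a variable to \<open>V\<close>, and \<open>p\<close> and \<open>q\<close> are coprime because
  their variables are disjoint.\<close>

lemma R_eq_polys_in: "R n = polys_in {0..n}"
  by (simp add: R_def polys_in_def)

lemma polys_in_mono: "V \<subseteq> W \<Longrightarrow> p \<in> polys_in V \<Longrightarrow> p \<in> polys_in W"
  by (fastforce simp: polys_in_def)

lemma polys_in_UNIV [simp]: "p \<in> polys_in UNIV"
  by (simp add: polys_in_def)

lemma polys_in_0 [simp, intro]: "0 \<in> polys_in V"
  by (simp add: polys_in_def)

lemma polys_in_cst [simp, intro]: "cst c \<in> polys_in V"
  by (auto simp: polys_in_def cst_def)

lemma polys_in_1 [simp, intro]: "(1 :: ('v, 'k::zero_neq_one) mpol) \<in> polys_in V"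
  by (auto simp: polys_in_def)

lemma polys_in_X [simp]: "(X v :: ('v, 'k::zero_neq_one) mpol) \<in> polys_in V \<longleftrightarrow> v \<in> V"
  by (auto simp: polys_in_def X_def)

lemma polys_in_add [intro]:
  fixes p q :: "('v, 'k::monoid_add) mpol"
  shows "p \<in> polys_in V \<Longrightarrow> q \<in> polys_in V \<Longrightarrow> p + q \<in> polys_in V"
  using keys_add[of p q] by (fastforce simp: polys_in_def)

lemma polys_in_uminus [intro]:
  fixes p :: "('v, 'k::ab_group_add) mpol"
  shows "p \<in> polys_in V \<Longrightarrow> - p \<in> polys_in V"
  by (auto simp: polys_in_def in_keys_iff)

lemma polys_in_diff [intro]:
  fixes p q :: "('v, 'k::ab_group_add) mpol"
  shows "p \<in> polys_in V \<Longrightarrow> q \<in> polys_in V \<Longrightarrow> p - q \<in> polys_in V"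
  using polys_in_add[of p V "- q"] polys_in_uminus[of q V] by simp

lemma polys_in_mult [intro]:
  fixes p q :: "('v, 'k::semiring_0) mpol"
  assumes "p \<in> polys_in V" "q \<in> polys_in V"
  shows "p * q \<in> polys_in V"
  unfolding polys_in_def
proof safe
  fix t v assume t: "t \<in> Poly_Mapping.keys (p * q)" "v \<in> Poly_Mapping.keys t"
  then obtain a b where "t = a + b" "a \<in> Poly_Mapping.keys p" "b \<in> Poly_Mapping.keys q"
    using keys_mult[of p q] by auto
  with t(2) keys_add[of a b] assms show "v \<in> V"
    by (fastforce simp: polys_in_def)
qed

lemma polys_in_sum [intro]:
  fixes f :: "'a \<Rightarrow> ('v, 'k::comm_monoid_add) mpol"
  shows "(\<And>i. i \<in> A \<Longrightarrow> f i \<in> polys_in V) \<Longrightarrow> sum f A \<in> polys_in V"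
  by (induction A rule: infinite_finite_induct) auto

lemma polys_in_prod [intro]:
  fixes f :: "'a \<Rightarrow> ('v, 'k::comm_semiring_1) mpol"
  shows "(\<And>i. i \<in> A \<Longrightarrow> f i \<in> polys_in V) \<Longrightarrow> prod f A \<in> polys_in V"
  by (induction A rule: infinite_finite_induct) auto

lemma polys_in_power [intro]:
  fixes p :: "('v, 'k::comm_semiring_1) mpol"
  shows "p \<in> polys_in V \<Longrightarrow> p ^ k \<in> polys_in V"
  by (induction k) auto

lemma polys_in_finite_vars:
  obtains V where "finite V" "p \<in> polys_in V"
  by (rule that[of "\<Union>t\<in>Poly_Mapping.keys p. Poly_Mapping.keys t"]) (auto simp: polys_in_def)

section \<open>Constants and monomials\<close>

lemma cst_0 [simp]: "cst 0 = 0"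
  by (simp add: cst_def)

lemma cst_1 [simp]: "cst (1 :: 'k::zero_neq_one) = (1 :: ('v, 'k) mpol)"
  by (simp add: cst_def)

lemma cst_add: "cst (a + b :: 'k::monoid_add) = cst a + cst b"
  by (simp add: cst_def single_add)

lemma cst_uminus: "cst (- a :: 'k::ab_group_add) = - cst a"
  by (simp add: cst_def single_uminus)

lemma cst_diff: "cst (a - b :: 'k::cancel_comm_monoid_add) = cst a - cst b"
  by (simp add: cst_def single_diff)

lemma cst_mult: "cst (a * b :: 'k::semiring_0) = cst a * cst b"
  by (simp add: cst_def mult_single)

lemma cst_of_nat: "cst (of_nat k :: 'k::semiring_1) = of_nat k"
  by (simp add: cst_def)

lemma cst_prod: "cst (prod f A :: 'k::comm_semiring_1) = prod (\<lambda>i. cst (f i)) A"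
  by (induction A rule: infinite_finite_induct) (auto simp: cst_mult)

lemma cst_inj [simp]: "cst a = cst b \<longleftrightarrow> a = b"
  by (metis cst_def lookup_single_eq)

lemma cst_eq_0_iff [simp]: "cst a = 0 \<longleftrightarrow> a = 0"
  using cst_inj[of a 0] by (simp del: cst_inj)

lemma X_nonzero [simp]: "(X v :: ('v, 'k::zero_neq_one) mpol) \<noteq> 0"
proof
  assume "(X v :: ('v, 'k::zero_neq_one) mpol) = 0"
  then have "Poly_Mapping.keys (X v :: ('v, 'k::zero_neq_one) mpol) = {}" by simp
  then show False by (simp add: X_def)
qed

lemma X_power: "(X v ^ k :: ('v, 'k::comm_semiring_1) mpol) = Poly_Mapping.single (Poly_Mapping.single v k) 1"
  by (induction k) (auto simp: X_def mult_single simp flip: single_add)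

lemma poly_mapping_sum_single:
  fixes p :: "'a \<Rightarrow>\<^sub>0 'b::comm_monoid_add"
  shows "p = (\<Sum>t\<in>Poly_Mapping.keys p. Poly_Mapping.single t (Poly_Mapping.lookup p t))"
proof (rule poly_mapping_eqI)
  fix k
  show "Poly_Mapping.lookup p k =
    Poly_Mapping.lookup (\<Sum>t\<in>Poly_Mapping.keys p. Poly_Mapping.single t (Poly_Mapping.lookup p t)) k"
    by (cases "k \<in> Poly_Mapping.keys p")
      (auto simp: lookup_sum lookup_single when_def in_keys_iff)
qed

lemma prod_X_power:
  assumes "finite A"
  shows "(\<Prod>v\<in>A. X v ^ e v :: ('v, 'k::comm_semiring_1) mpol) =
    Poly_Mapping.single (\<Sum>v\<in>A. Poly_Mapping.single v (e v)) 1"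
  using assms by induction (auto simp: X_power mult_single)

lemma single_eq_cst_mult_prod_X:
  "(Poly_Mapping.single t c :: ('v, 'k::comm_semiring_1) mpol) =
     cst c * (\<Prod>v\<in>Poly_Mapping.keys t. X v ^ Poly_Mapping.lookup t v)"
proof -
  have "(\<Prod>v\<in>Poly_Mapping.keys t. X v ^ Poly_Mapping.lookup t v) =
      (Poly_Mapping.single t 1 :: ('v, 'k) mpol)"
    by (subst prod_X_power) (simp_all flip: poly_mapping_sum_single)
  then show ?thesis
    by (simp add: cst_def mult_single)
qed

text \<open>The induction steps retain the membership of \<open>p\<close> and \<open>q\<close>,
  since a map in \<open>Der n\<close> is additive and satisfies the Leibniz rule on
  \<open>R n\<close> only.\<close>

lemma polys_in_induct [consumes 1, case_names cst X add mult]: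
  fixes p :: "('v, 'k::comm_semiring_1) mpol"
  assumes "p \<in> polys_in V"
    and cst: "\<And>c. P (cst c)" and X: "\<And>v. v \<in> V \<Longrightarrow> P (X v)"
    and add: "\<And>p q. p \<in> polys_in V \<Longrightarrow> q \<in> polys_in V \<Longrightarrow> P p \<Longrightarrow> P q \<Longrightarrow> P (p + q)"
    and mult: "\<And>p q. p \<in> polys_in V \<Longrightarrow> q \<in> polys_in V \<Longrightarrow> P p \<Longrightarrow> P q \<Longrightarrow> P (p * q)"
  shows "P p"
proof -
  let ?Q = "\<lambda>p. p \<in> polys_in V \<and> P p"
  have one: "?Q 1" using cst[of 1] by simp
  have pow: "?Q (X v ^ k)" if "v \<in> V" for v k
    by (induction k) (use one that X in \<open>auto intro: mult\<close>)
  have prod: "?Q (\<Prod>v\<in>A. X v ^ e v)" if "finite A" "A \<subseteq> V" for A and e :: "'v \<Rightarrow> nat"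
    using that by (induction A) (use one pow in \<open>auto intro!: mult\<close>)
  have mono: "?Q (Poly_Mapping.single t c)" if "Poly_Mapping.keys t \<subseteq> V" for t c
    unfolding single_eq_cst_mult_prod_X
    using prod[OF _ that] by (auto intro!: mult cst)
  have sum: "?Q (\<Sum>t\<in>A. Poly_Mapping.single t (f t))"
    if "finite A" "\<And>t. t \<in> A \<Longrightarrow> Poly_Mapping.keys t \<subseteq> V" for A f
    using that
  proof (induction A)
    case empty
    show ?case using cst[of 0] by simp
  next
    case (insert t A)
    then have "?Q (Poly_Mapping.single t (f t))" "?Q (\<Sum>t\<in>A. Poly_Mapping.single t (f t))"
      using mono by auto
    with insert.hyps show ?case by (auto intro: add)
  qed
  show ?thesis
    using sum[of "Poly_Mapping.keys p" "Poly_Mapping.lookup p"] assms(1)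
    by (auto simp: polys_in_def simp flip: poly_mapping_sum_single)
qed

lemmas mpol_induct [case_names cst X add mult] = polys_in_induct[OF polys_in_UNIV]


section \<open>Substitution homomorphisms\<close>

text \<open>The map \<iota> on coefficients is left open so that one construction gives both
  evaluation at a point and the reading of a polynomial as a univariate one over the other
  variables.\<close>

locale coeff_hom =
  fixes \<iota> :: "'k::comm_semiring_1 \<Rightarrow> 'b::comm_semiring_1"
  assumes hom_0: "\<iota> 0 = 0" and hom_1: "\<iota> 1 = 1"
    and hom_add: "\<iota> (x + y) = \<iota> x + \<iota> y" and hom_mult: "\<iota> (x * y) = \<iota> x * \<iota> y"
begin

definition subst :: "('v \<Rightarrow> 'b) \<Rightarrow> ('v, 'k) mpol \<Rightarrow> 'b" where
  "subst \<sigma> p = (\<Sum>t\<in>Poly_Mapping.keys p. \<iota> (Poly_Mapping.lookup p t) *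
     (\<Prod>v\<in>Poly_Mapping.keys t. \<sigma> v ^ Poly_Mapping.lookup t v))"

text \<open>Cancellation may remove keys from a sum, so both summands are spread over one common
  finite set; a missing key contributes \<iota> 0 = 0.\<close>

lemma subst_superset:
  assumes "finite T" "Poly_Mapping.keys p \<subseteq> T"
  shows "subst \<sigma> p = (\<Sum>t\<in>T. \<iota> (Poly_Mapping.lookup p t) *
     (\<Prod>v\<in>Poly_Mapping.keys t. \<sigma> v ^ Poly_Mapping.lookup t v))"
  unfolding subst_def using assms
  by (intro sum.mono_neutral_left) (auto simp: in_keys_iff hom_0)

lemma subst_add: "subst \<sigma> (p + q) = subst \<sigma> p + subst \<sigma> q"
proof -
  let ?T = "Poly_Mapping.keys p \<union> Poly_Mapping.keys q"
  have "finite ?T" "Poly_Mapping.keys (p + q) \<subseteq> ?T" using keys_add[of p q] by auto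
  then show ?thesis
    by (simp add: subst_superset[where T = ?T] lookup_add hom_add algebra_simps sum.distrib)
qed

lemma subst_0 [simp]: "subst \<sigma> 0 = 0"
  by (simp add: subst_def)

lemma subst_sum: "subst \<sigma> (sum f A) = (\<Sum>i\<in>A. subst \<sigma> (f i))"
  by (induction A rule: infinite_finite_induct) (auto simp: subst_add)

lemma subst_single: "subst \<sigma> (Poly_Mapping.single t c) =
    \<iota> c * (\<Prod>v\<in>Poly_Mapping.keys t. \<sigma> v ^ Poly_Mapping.lookup t v)"
  by (subst subst_superset[where T = "{t}"]) auto

lemma subst_cst [simp]: "subst \<sigma> (cst c) = \<iota> c"
  by (simp add: cst_def subst_single)

lemma subst_1 [simp]: "subst \<sigma> 1 = 1"
  using subst_cst[of \<sigma> 1] by (simp add: hom_1)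

lemma subst_X [simp]: "subst \<sigma> (X v) = \<sigma> v"
  by (simp add: X_def subst_single hom_1)

lemma subst_mult:
  fixes \<sigma> :: "'v \<Rightarrow> 'b"
  shows "subst \<sigma> (p * q) = subst \<sigma> p * subst \<sigma> q"
proof -
  let ?m = "\<lambda>t. \<Prod>v\<in>Poly_Mapping.keys t. \<sigma> v ^ Poly_Mapping.lookup t v"
  have m_superset: "?m t = (\<Prod>v\<in>T. \<sigma> v ^ Poly_Mapping.lookup t v)"
    if "finite T" "Poly_Mapping.keys t \<subseteq> T" for t T
    using that by (intro prod.mono_neutral_left) (auto simp: in_keys_iff)
  have m_add: "?m (s + t) = ?m s * ?m t" for s t :: "'v \<Rightarrow>\<^sub>0 nat"
  proof -
    let ?T = "Poly_Mapping.keys s \<union> Poly_Mapping.keys t"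
    have "finite ?T" "Poly_Mapping.keys (s + t) \<subseteq> ?T" using keys_add[of s t] by auto
    then show ?thesis
      by (subst (1 2 3) m_superset[of ?T]) (auto simp: lookup_add power_add prod.distrib)
  qed
  have single: "subst \<sigma> (Poly_Mapping.single s a * Poly_Mapping.single t b) =
      subst \<sigma> (Poly_Mapping.single s a) * subst \<sigma> (Poly_Mapping.single t b)" for s t a b
    by (simp add: mult_single subst_single m_add hom_mult algebra_simps)
  have "subst \<sigma> (p * q) = subst \<sigma> ((\<Sum>t\<in>Poly_Mapping.keys p. Poly_Mapping.single t (Poly_Mapping.lookup p t)) *
      (\<Sum>t\<in>Poly_Mapping.keys q. Poly_Mapping.single t (Poly_Mapping.lookup q t)))"
    by (simp flip: poly_mapping_sum_single)
  also have "\<dots> = subst \<sigma> (\<Sum>t\<in>Poly_Mapping.keys p. Poly_Mapping.single t (Poly_Mapping.lookup p t)) *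
      subst \<sigma> (\<Sum>t\<in>Poly_Mapping.keys q. Poly_Mapping.single t (Poly_Mapping.lookup q t))"
    by (simp add: sum_product subst_sum single)
  finally show ?thesis
    by (simp flip: poly_mapping_sum_single)
qed

lemma subst_prod: "subst \<sigma> (prod f A) = (\<Prod>i\<in>A. subst \<sigma> (f i))"
  by (induction A rule: infinite_finite_induct) (auto simp: subst_mult)

lemma subst_power: "subst \<sigma> (p ^ k) = subst \<sigma> p ^ k"
  by (induction k) (auto simp: subst_mult)

end

interpretation eval: coeff_hom "\<lambda>c::'k::comm_semiring_1. c"
  by unfold_locales auto

lemma eval_mpol_eq_subst: "eval_mpol p x = eval.subst x p"
  by (simp add: eval_mpol_def eval.subst_def)

section \<open>Degree in one variable\<close>

interpretation const: coeff_hom "\<lambda>c::'k::comm_semiring_1. [:cst c :: ('v, 'k) mpol:]"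
  by unfold_locales (auto simp: cst_add cst_mult one_pCons mult.commute)

text \<open>The coefficients stay in the same polynomial type and merely avoid \<open>y\<close>. A
  variable can thus be singled out without changing the ring, as the induction on sets of variables
  requires.\<close>

definition upoly :: "'v \<Rightarrow> ('v, 'k::comm_semiring_1) mpol \<Rightarrow> ('v, 'k) mpol poly" where
  "upoly y = const.subst (\<lambda>v. if v = y then [:0, 1:] else [:X v:])"

abbreviation degree_in :: "'v \<Rightarrow> ('v, 'k::comm_semiring_1) mpol \<Rightarrow> nat" where
  "degree_in y p \<equiv> degree (upoly y p)"

lemma upoly_0 [simp]: "upoly y 0 = 0"
  and upoly_cst [simp]: "upoly y (cst c) = [:cst c:]"
  and upoly_add: "upoly y (p + q) = upoly y p + upoly y q"
  and upoly_mult: "upoly y (p * q) = upoly y p * upoly y q"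
  and upoly_X: "upoly y (X v) = (if v = y then [:0, 1:] else [:X v:])"
  and upoly_power: "upoly y (p ^ k) = upoly y p ^ k"
  by (simp_all add: upoly_def const.subst_add const.subst_mult const.subst_power)

lemma upoly_diff:
  fixes p q :: "('v, 'k::comm_ring_1) mpol"
  shows "upoly y (p - q) = upoly y p - upoly y q"
  using upoly_add[of y "p - q" q] by (simp add: algebra_simps)

text \<open>Injectivity of \<open>upoly\<close> follows, and divisibility of univariate polynomials
  can be carried back.\<close>

lemma poly_upoly: "poly (upoly y p) (X y) = p"
  by (induction p rule: mpol_induct) (auto simp: upoly_add upoly_mult upoly_X)

lemma upoly_eq_iff [simp]: "upoly y p = upoly y q \<longleftrightarrow> p = q"
  by (metis poly_upoly)

lemma upoly_eq_0_iff [simp]: "upoly y p = 0 \<longleftrightarrow> p = 0"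
  by (metis upoly_0 upoly_eq_iff)

lemma coeff_upoly_polys_in: "p \<in> polys_in V \<Longrightarrow> coeff (upoly y p) i \<in> polys_in (V - {y})"
proof (induction p arbitrary: i rule: polys_in_induct)
  case (cst c)
  show ?case by (simp add: coeff_pCons split: nat.splits)
next
  case (X v)
  then show ?case by (simp add: upoly_X coeff_pCons split: nat.splits)
next
  case (add p q)
  then show ?case unfolding upoly_add coeff_add by (intro polys_in_add)
next
  case (mult p q)
  then show ?case unfolding upoly_mult coeff_mult by (intro polys_in_sum polys_in_mult)
qed

lemma upoly_const: "p \<in> polys_in V \<Longrightarrow> y \<notin> V \<Longrightarrow> upoly y p = [:p:]"
  by (induction p rule: polys_in_induct) (auto simp: upoly_add upoly_mult upoly_X mult.commute)

text \<open>The linear order on the variables orders the monomials, which is how the polynomial ring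
  becomes an integral domain.\<close>

lemma degree_in_mult:
  fixes p q :: "('v::linorder, 'k::idom) mpol"
  shows "p \<noteq> 0 \<Longrightarrow> q \<noteq> 0 \<Longrightarrow> degree_in y (p * q) = degree_in y p + degree_in y q"
  by (simp add: upoly_mult degree_mult_eq)

lemma degree_in_0_imp: 
  assumes "degree_in y p = 0" shows "p \<in> polys_in (- {y})"
proof -
  obtain c where c: "upoly y p = [:c:]" using assms by (metis degree_eq_zeroE)
  then have "p = c" using poly_upoly[of y p] by simp
  then show ?thesis using coeff_upoly_polys_in[of p UNIV y 0] c by (simp add: Compl_eq_Diff_UNIV)
qed

text \<open>Degrees add over products, so in this form it is clear that a divisor of a non-zero
  polynomial involves no further variables (\<open>polys_in_dvd\<close>).\<close>

lemma polys_in_iff_degree_in: "p \<in> polys_in V \<longleftrightarrow> (\<forall>y. y \<notin> V \<longrightarrow> degree_in y p = 0)"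
proof
  assume deg: "\<forall>y. y \<notin> V \<longrightarrow> degree_in y p = 0"
  have "p \<in> polys_in (- {y})" if "y \<notin> V" for y
    by (rule degree_in_0_imp) (use deg that in simp)
  then have "y \<notin> Poly_Mapping.keys t" if "y \<notin> V" "t \<in> Poly_Mapping.keys p" for y t
    using that unfolding polys_in_def by blast
  then show "p \<in> polys_in V" unfolding polys_in_def by blast
qed (simp add: upoly_const)

lemma polys_in_multD:
  fixes p q :: "('v::linorder, 'k::idom) mpol"
  assumes "p * q \<in> polys_in V" "p \<noteq> 0"
  shows "q \<in> polys_in V"
proof (cases "q = 0")
  case False
  then have "degree_in y (p * q) = degree_in y p + degree_in y q" for y
    using assms(2) by (rule degree_in_mult[rotated])
  then show ?thesis using assms(1) by (simp add: polys_in_iff_degree_in)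
qed auto

lemma polys_in_dvd:
  fixes p q :: "('v::linorder, 'k::idom) mpol"
  assumes "p dvd q" "q \<in> polys_in V" "q \<noteq> 0"
  shows "p \<in> polys_in V"
proof -
  from assms(1) obtain s where "q = s * p" by (auto simp: dvd_def mult.commute)
  with assms show ?thesis using polys_in_multD[of s p V] by auto
qed

lemma polys_in_empty: "p \<in> polys_in {} \<Longrightarrow> \<exists>c. p = cst (c :: 'k::comm_semiring_1)"
proof (induction p rule: polys_in_induct)
  case (add p q)
  then show ?case by (metis cst_add)
next
  case (mult p q)
  then show ?case by (metis cst_mult)
qed auto

lemma unit_iff_cst:
  fixes p :: "('v::linorder, 'k::field) mpol"
  shows "p dvd 1 \<longleftrightarrow> (\<exists>c. c \<noteq> 0 \<and> p = cst c)"
proof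
  assume "p dvd 1"
  then have "p \<in> polys_in {}" "p \<noteq> 0" by (auto intro: polys_in_dvd[of p 1])
  then show "\<exists>c. c \<noteq> 0 \<and> p = cst c" using polys_in_empty by fastforce
next
  assume "\<exists>c. c \<noteq> 0 \<and> p = cst c"
  then obtain c where "c \<noteq> 0" "p = cst c" by blast
  then have "p * cst (inverse c) = 1" by (simp flip: cst_mult)
  then show "p dvd 1" by (metis dvdI)
qed

section \<open>Unique factorisation\<close>

lemma irreducible_dvd_irreducible:
  fixes p q :: "'a::idom"
  assumes "irreducible p" "irreducible q" "p dvd q"
  shows "q dvd p"
proof -
  from assms(3) obtain s where s: "q = p * s" by blast
  with assms(1,2) have "s dvd 1" by (auto dest: irreducibleD irreducible_not_unit)
  then obtain t where "s * t = 1" by (metis dvdE)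
  then have "p = q * t" using s by (metis mult.assoc mult.right_neutral)
  then show ?thesis by simp
qed

lemma dvd_mult_unit_cancel:
  fixes a b u :: "'a::comm_semiring_1"
  assumes "u dvd 1" "a dvd u * b"
  shows "a dvd b"
proof -
  from assms(1) obtain t where "1 = u * t" by blast
  then have "b = u * b * t" by (metis mult.assoc mult.commute mult.left_neutral)
  with assms(2) show ?thesis by (metis dvd_mult2)
qed

text \<open>On non-zero polynomials the total of these degrees is additive and vanishes on units
  only; it is the measure by which factorisation terminates.\<close>

lemma degree_in_sum_pos:
  fixes p :: "('v::linorder, 'k::field) mpol"
  assumes "finite V" "p \<in> polys_in V" "p \<noteq> 0" "\<not> p dvd 1"
  shows "(\<Sum>v\<in>V. degree_in v p) > 0"
proof (rule ccontr)
  assume "\<not> ?thesis"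
  with assms(1) have "degree_in v p = 0" if "v \<in> V" for v
    using that by simp
  moreover have "degree_in v p = 0" if "v \<notin> V" for v
    using assms(2) that unfolding polys_in_iff_degree_in[of p] by simp
  ultimately have "p \<in> polys_in {}"
    unfolding polys_in_iff_degree_in by blast
  then show False using assms(3,4) polys_in_empty[of p] by (auto simp: unit_iff_cst)
qed

lemma ex_irreducible_dvd:
  fixes p :: "('v::linorder, 'k::field) mpol"
  assumes "p \<noteq> 0" "\<not> p dvd 1"
  obtains q where "irreducible q" "q dvd p"
proof -
  obtain V where V: "finite V" "p \<in> polys_in V" by (rule polys_in_finite_vars)
  have "\<exists>q. irreducible q \<and> q dvd p"
    using V(2) assms
  proof (induction "\<Sum>v\<in>V. degree_in v p" arbitrary: p rule: less_induct)
    case less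
    show ?case
    proof (cases "irreducible p")
      case False
      with less.prems obtain a b where ab: "p = a * b" "\<not> a dvd 1" "\<not> b dvd 1"
        by (auto simp: irreducible_def)
      with less.prems have nz: "a \<noteq> 0" "b \<noteq> 0" by auto
      have in_V: "a \<in> polys_in V" "b \<in> polys_in V"
        using polys_in_dvd[of a p V] polys_in_dvd[of b p V] less.prems ab by auto
      have "(\<Sum>v\<in>V. degree_in v b) > 0"
        using V(1) in_V nz ab by (intro degree_in_sum_pos) auto
      then have "(\<Sum>v\<in>V. degree_in v a) < (\<Sum>v\<in>V. degree_in v p)"
        using nz by (simp add: ab(1) degree_in_mult sum.distrib)
      from less.hyps[OF this in_V(1) nz(1) ab(2)] obtain q where "irreducible q" "q dvd a" by blast
      with ab show ?thesis by (auto intro: dvd_trans)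
    qed auto
  qed
  with that show thesis by blast
qed

text \<open>This rests on the existence of a factorisation and not on its uniqueness, so the rule
  can already serve in the proof of primality.\<close>

lemma irreducible_factor_induct [consumes 1, case_names unit irreducible]:
  fixes p :: "('v::linorder, 'k::field) mpol"
  assumes "p \<noteq> 0"
    and unit: "\<And>u. u dvd 1 \<Longrightarrow> P u"
    and step: "\<And>q p. irreducible q \<Longrightarrow> p \<noteq> 0 \<Longrightarrow> P p \<Longrightarrow> P (q * p)"
  shows "P p"
proof -
  obtain V where V: "finite V" "p \<in> polys_in V" by (rule polys_in_finite_vars)
  show ?thesis
    using V(2) assms(1)
  proof (induction "\<Sum>v\<in>V. degree_in v p" arbitrary: p rule: less_induct)
    case less
    show ?case
    proof (cases "p dvd 1")
      case False
      with less.prems obtain q where q: "irreducible q" "q dvd p" by (metis ex_irreducible_dvd)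
      then obtain s where s: "p = q * s" by blast
      with less.prems have nz: "q \<noteq> 0" "s \<noteq> 0" by auto
      have in_V: "q \<in> polys_in V" "s \<in> polys_in V"
        using polys_in_dvd[of q p V] polys_in_dvd[of s p V] less.prems s by auto
      have "(\<Sum>v\<in>V. degree_in v q) > 0"
        using V(1) in_V nz q irreducible_not_unit by (intro degree_in_sum_pos) auto
      then have "(\<Sum>v\<in>V. degree_in v s) < (\<Sum>v\<in>V. degree_in v p)"
        using nz by (simp add: s degree_in_mult sum.distrib)
      from step[OF q(1) nz(2) less.hyps[OF this in_V(2) nz(2)]] show ?thesis by (simp add: s)
    qed (rule unit)
  qed
qed

section \<open>Primality of irreducible polynomials\<close>

definition prime_in :: "'v set \<Rightarrow> ('v, 'k::comm_semiring_1) mpol \<Rightarrow> bool" where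
  "prime_in V q \<longleftrightarrow> (\<forall>f\<in>polys_in V. \<forall>g\<in>polys_in V. q dvd f * g \<longrightarrow> q dvd f \<or> q dvd g)"

text \<open>Gauss's argument: take the least indices at which the coefficients of \<open>f\<close>
  and \<open>g\<close> escape \<open>c\<close>. In the coefficient of the product at their sum,
  every summand but one is divisible by \<open>c\<close>. Primality is demanded for these
  coefficients only, as it will be known in a smaller ring only.\<close>

lemma const_poly_dvd_multD:
  fixes c :: "'a::idom"
  assumes prime: "\<And>i j. c dvd coeff f i * coeff g j \<Longrightarrow> c dvd coeff f i \<or> c dvd coeff g j"
    and dvd: "[:c:] dvd f * g"
  shows "[:c:] dvd f \<or> [:c:] dvd g"
proof (rule ccontr)
  assume "\<not> ?thesis"
  then have ex: "\<exists>i. \<not> c dvd coeff f i" "\<exists>j. \<not> c dvd coeff g j"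
    by (auto simp: const_poly_dvd_iff)
  define i where "i = (LEAST i. \<not> c dvd coeff f i)"
  define j where "j = (LEAST j. \<not> c dvd coeff g j)"
  have i: "\<not> c dvd coeff f i" "\<And>k. k < i \<Longrightarrow> c dvd coeff f k"
    unfolding i_def using LeastI_ex[OF ex(1)] by (blast, blast dest: not_less_Least)
  have j: "\<not> c dvd coeff g j" "\<And>k. k < j \<Longrightarrow> c dvd coeff g k"
    unfolding j_def using LeastI_ex[OF ex(2)] by (blast, blast dest: not_less_Least)
  have "c dvd (\<Sum>k\<in>{..i + j} - {i}. coeff f k * coeff g (i + j - k))"
  proof (rule dvd_sum)
    fix k assume "k \<in> {..i + j} - {i}"
    then have "k < i \<or> i + j - k < j" by auto
    then show "c dvd coeff f k * coeff g (i + j - k)"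
      using i(2) j(2) by (auto intro: dvd_mult dvd_mult2)
  qed
  moreover have "c dvd coeff (f * g) (i + j)"
    using dvd by (simp add: const_poly_dvd_iff)
  moreover have "coeff (f * g) (i + j) =
      coeff f i * coeff g j + (\<Sum>k\<in>{..i + j} - {i}. coeff f k * coeff g (i + j - k))"
    by (simp add: coeff_mult sum.remove[of "{..i + j}" i])
  ultimately have "c dvd coeff f i * coeff g j"
    using dvd_add_left_iff by auto
  with prime i(1) j(1) show False by blast
qed

lemma const_poly_dvd_upoly_iff:
  assumes "c \<in> polys_in V" "y \<notin> V"
  shows "[:c:] dvd upoly y p \<longleftrightarrow> c dvd p"
proof
  assume "[:c:] dvd upoly y p"
  then obtain s where "upoly y p = [:c:] * s" by blast
  then have "p = c * poly s (X y)" using poly_upoly[of y p] by simp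
  then show "c dvd p" by simp
next
  assume "c dvd p"
  then obtain s where "p = c * s" by blast
  then show "[:c:] dvd upoly y p" by (simp only: upoly_mult upoly_const[OF assms] dvd_triv_left)
qed

text \<open>Seen as polynomials in \<open>y\<close>, \<open>f\<close> and \<open>g\<close> have
  their coefficients in the smaller ring, where \<open>c\<close> is prime.\<close>

lemma prime_in_insert:
  fixes c :: "('v::linorder, 'k::idom) mpol"
  assumes "prime_in V c" "c \<in> polys_in V" "y \<notin> V"
  shows "prime_in (insert y V) c"
  unfolding prime_in_def
proof safe
  fix f g :: "('v, 'k) mpol"
  assume fg: "f \<in> polys_in (insert y V)" "g \<in> polys_in (insert y V)" "c dvd f * g" "\<not> c dvd g"
  have coeffs: "coeff (upoly y f) i \<in> polys_in V" "coeff (upoly y g) i \<in> polys_in V" for i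
    using coeff_upoly_polys_in[OF fg(1), of y i] coeff_upoly_polys_in[OF fg(2), of y i] assms(3) by auto
  have "[:c:] dvd upoly y f * upoly y g"
    using fg(3) const_poly_dvd_upoly_iff[OF assms(2,3), of "f * g"] by (simp only: upoly_mult)
  then have "[:c:] dvd upoly y f \<or> [:c:] dvd upoly y g"
    by (rule const_poly_dvd_multD[rotated]) (use assms(1) coeffs in \<open>auto simp: prime_in_def\<close>)
  then show "c dvd f" using fg(4) const_poly_dvd_upoly_iff[OF assms(2,3)] by blast
qed

text \<open>The leading coefficient of \<open>h\<close> cannot be inverted without leaving the ring,
  so each division step multiplies by it instead; \<open>c\<close> collects these factors.\<close>

lemma pseudo_division:
  fixes q h :: "('v::linorder, 'k::idom) mpol"
  assumes y: "y \<notin> V" and h: "h \<in> polys_in (insert y V)" "h \<noteq> 0" and q: "q \<in> polys_in (insert y V)"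
  shows "\<exists>c s. c \<in> polys_in V \<and> c \<noteq> 0 \<and> s \<in> polys_in (insert y V) \<and>
    (c * q - h * s = 0 \<or> degree_in y (c * q - h * s) < degree_in y h)"
  using q
proof (induction "degree_in y q" arbitrary: q rule: less_induct)
  case less
  show ?case
  proof (cases "q = 0 \<or> degree_in y q < degree_in y h")
    case True
    then show ?thesis by (intro exI[of _ 1] exI[of _ 0]) auto
  next
    case False
    define d where "d = degree_in y q - degree_in y h"
    define a where "a = lead_coeff (upoly y q)"
    define b where "b = lead_coeff (upoly y h)"
    \<comment> \<open>Both terms have leading coefficient \<open>a * b\<close> and the same degree
      in \<open>y\<close>, so the difference drops in degree.\<close>
    define q' where "q' = b * q - h * (a * X y ^ d)"
    have ab: "a \<in> polys_in V" "b \<in> polys_in V" "a \<noteq> 0" "b \<noteq> 0"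
      using coeff_upoly_polys_in[OF less.prems, of y] coeff_upoly_polys_in[OF h(1), of y] y False h(2)
      by (auto simp: a_def b_def)
    have sub: "p \<in> polys_in V \<Longrightarrow> p \<in> polys_in (insert y V)" for p :: "('v, 'k) mpol"
      using polys_in_mono[of V "insert y V" p] by blast
    have q'_in: "q' \<in> polys_in (insert y V)"
      unfolding q'_def using less.prems h(1) ab sub by (intro polys_in_diff polys_in_mult polys_in_power) auto
    have up: "upoly y q' = smult b (upoly y q) - smult a (monom 1 d * upoly y h)"
      by (simp add: q'_def upoly_diff upoly_mult upoly_power upoly_X upoly_const[OF ab(1) y]
          upoly_const[OF ab(2) y] monom_altdef mult_ac)
    have deg: "degree (monom 1 d * upoly y h) = degree_in y q"
      using False h(2) by (subst degree_mult_eq) (auto simp: d_def degree_monom_eq monom_eq_0_iff)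
    have "degree_in y q' \<le> degree_in y q"
      unfolding up using ab by (intro degree_diff_le) (simp_all add: deg)
    moreover have "coeff (upoly y q') (degree_in y q) = 0"
      using False by (simp add: up coeff_monom_mult d_def a_def b_def)
    ultimately have "q' = 0 \<or> degree_in y q' < degree_in y q"
      by (metis leading_coeff_0_iff nat_less_le upoly_eq_0_iff)
    then show ?thesis
    proof
      assume "q' = 0"
      moreover have "a * X y ^ d \<in> polys_in (insert y V)"
        using ab sub by (intro polys_in_mult polys_in_power) simp_all
      ultimately show ?thesis using ab unfolding q'_def by blast
    next
      assume "degree_in y q' < degree_in y q"
      from less.hyps[OF this q'_in] obtain c s where cs: "c \<in> polys_in V" "c \<noteq> 0" "s \<in> polys_in (insert y V)"
        "c * q' - h * s = 0 \<or> degree_in y (c * q' - h * s) < degree_in y h" by blast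
      have eq: "c * q' - h * s = c * b * q - h * (s + c * a * X y ^ d)"
        by (simp add: q'_def algebra_simps)
      have "s + c * a * X y ^ d \<in> polys_in (insert y V)"
        using cs ab sub by (intro polys_in_add polys_in_mult polys_in_power) simp_all
      moreover have "c * b \<in> polys_in V" "c * b \<noteq> 0" using cs ab by auto
      ultimately show ?thesis using cs(4) unfolding eq by blast
    qed
  qed
qed

text \<open>The step of Gauss's lemma: primality in \<open>K[V]\<close> gives unique factorisation of the contents
  that pseudo-division introduces, so they can be cancelled one prime at a time.\<close>

context
  fixes V :: "'v::linorder set" and y :: 'v and q :: "('v, 'k::field) mpol"
  assumes prime_V: "\<And>c :: ('v, 'k) mpol. c \<in> polys_in V \<Longrightarrow> irreducible c \<Longrightarrow> prime_in V c"
    and y: "y \<notin> V" and irr: "irreducible q" and q_in: "q \<in> polys_in (insert y V)"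
    and deg_q: "degree_in y q > 0"
begin

text \<open>A prime factor \<open>p\<close> of \<open>c\<close> divides \<open>q * t\<close>. It
  cannot divide \<open>q\<close>, which would then be associate to \<open>p\<close> and free of
  \<open>y\<close>; so it divides \<open>t\<close> and cancels.\<close>

lemma dvd_cancel_content:
  assumes "c \<noteq> 0" "c \<in> polys_in V" "f \<in> polys_in (insert y V)" "q dvd c * f"
  shows "q dvd f"
  using assms
proof (induction c rule: irreducible_factor_induct)
  case (unit u)
  then show ?case using dvd_mult_unit_cancel by blast
next
  case (irreducible p c)
  show ?case
  proof (cases "f = 0")
    case False
    have nz: "p \<noteq> 0" using irreducible.hyps(1) by (metis not_irreducible_zero)
    have in_V: "p \<in> polys_in V" "c \<in> polys_in V"
      using polys_in_dvd[of p "p * c" V] polys_in_dvd[of c "p * c" V] irreducible.prems(1) irreducible.hyps nz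
      by auto
    then have prime: "prime_in (insert y V) p"
      using prime_V irreducible.hyps y by (intro prime_in_insert) auto
    from irreducible.prems obtain t where t: "p * c * f = q * t" by blast
    have "p * c \<in> polys_in (insert y V)" by (rule polys_in_mono[OF _ irreducible.prems(1)]) auto
    then have "q * t \<in> polys_in (insert y V)"
      unfolding t[symmetric] using irreducible.prems(2) by blast
    then have t_in: "t \<in> polys_in (insert y V)"
      using polys_in_multD[of q t] irr by (metis not_irreducible_zero)
    have "p dvd q * t" by (simp add: mult.assoc flip: t)
    then have "p dvd q \<or> p dvd t" using prime t_in q_in by (auto simp: prime_in_def)
    moreover have "\<not> p dvd q"
    proof
      assume "p dvd q"
      then have "q dvd p" using irreducible_dvd_irreducible irreducible.hyps irr by blast
      then have "q \<in> polys_in V" using in_V irreducible.hyps by (intro polys_in_dvd[of q p]) auto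
      then show False using deg_q y polys_in_iff_degree_in[of q V] by auto
    qed
    ultimately obtain t' where "t = p * t'" by blast
    with t have "p * (c * f) = p * (q * t')" by (simp add: mult_ac)
    then have "c * f = q * t'" using nz by simp
    then have "q dvd c * f" by simp
    then show ?thesis using irreducible.IH in_V irreducible.prems by blast
  qed auto
qed

text \<open>Each prime of \<open>c\<close> divides \<open>h\<close> or \<open>s\<close> and is
  removed there. What \<open>h\<close> loses is collected in \<open>c1\<close>, so up to content
  \<open>h\<close> is a divisor of \<open>q\<close>.\<close>

lemma split_content:
  assumes "c \<noteq> 0" "c \<in> polys_in V" "h \<in> polys_in (insert y V)" "s \<in> polys_in (insert y V)" "c * q = h * s"
  shows "\<exists>c1 h' s'. c1 \<in> polys_in V \<and> c1 \<noteq> 0 \<and> h = c1 * h' \<and> q = h' * s'"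
  using assms
proof (induction c arbitrary: h s rule: irreducible_factor_induct)
  case (unit u)
  then obtain t where t: "1 = u * t" by blast
  have "q = q * (u * t)" using t by (metis mult.right_neutral)
  then have "q = (u * q) * t" by (simp only: mult_ac)
  then have "q = (h * s) * t" by (simp only: unit.prems(4))
  then have "q = h * (t * s)" by (simp only: mult_ac)
  then show ?case by (intro exI[of _ 1] exI[of _ h] exI[of _ "t * s"]) auto
next
  case (irreducible p c)
  have "p \<noteq> 0" "q \<noteq> 0" using irreducible.hyps(1) irr by (metis not_irreducible_zero)+
  with irreducible.prems(4) irreducible.hyps(2) have nz: "p \<noteq> 0" "h \<noteq> 0" "s \<noteq> 0" by auto
  have in_V: "p \<in> polys_in V" "c \<in> polys_in V"
    using polys_in_dvd[of p "p * c" V] polys_in_dvd[of c "p * c" V] irreducible.prems(1) irreducible.hyps nz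
    by auto
  then have prime: "prime_in (insert y V) p"
    using prime_V irreducible.hyps y by (intro prime_in_insert) auto
  have "p dvd h * s" by (simp add: mult.assoc flip: irreducible.prems(4))
  then have "p dvd h \<or> p dvd s" using prime irreducible.prems by (auto simp: prime_in_def)
  then show ?case
  proof
    assume "p dvd h"
    then obtain h1 where h1: "h = p * h1" by blast
    with irreducible.prems(4) have "p * (c * q) = p * (h1 * s)" by (simp add: mult_ac)
    then have "c * q = h1 * s" using nz by simp
    moreover have "h1 \<in> polys_in (insert y V)"
      using polys_in_multD[of p h1] h1 irreducible.prems nz by auto
    ultimately obtain c1 h' s' where "c1 \<in> polys_in V" "c1 \<noteq> 0" "h1 = c1 * h'" "q = h' * s'"
      using irreducible.IH[of h1 s] irreducible.prems in_V by blast
    then show ?thesis using h1 in_V nz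
      by (intro exI[of _ "p * c1"] exI[of _ h'] exI[of _ s']) auto
  next
    assume "p dvd s"
    then obtain s1 where s1: "s = p * s1" by blast
    with irreducible.prems(4) have "p * (c * q) = p * (h * s1)" by (simp add: mult_ac)
    then have "c * q = h * s1" using nz by simp
    moreover have "s1 \<in> polys_in (insert y V)"
      using polys_in_multD[of p s1] s1 irreducible.prems nz by auto
    ultimately show ?thesis using irreducible.IH[of h s1] irreducible.prems in_V by blast
  qed
qed

text \<open>The combinations of \<open>q\<close> and \<open>f\<close> are treated as an ideal over
  the fraction field of the smaller ring: one of least degree in \<open>y\<close>, called
  \<open>h\<close>, divides both up to content. As \<open>q\<close> is irreducible, the primitive
  part of \<open>h\<close> is associate to \<open>q\<close>, which then divides \<open>f\<close>, or
  a unit, and then a Bezout relation gives \<open>q dvd g\<close>.\<close>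

lemma prime_in_insert_positive_degree: "prime_in (insert y V) q"
  unfolding prime_in_def
proof safe
  fix f g :: "('v, 'k) mpol"
  assume f: "f \<in> polys_in (insert y V)" and g: "g \<in> polys_in (insert y V)" and dvd: "q dvd f * g"
    and not_dvd: "\<not> q dvd g"
  define J where "J = (\<lambda>h. h \<in> polys_in (insert y V) \<and> h \<noteq> 0 \<and> (\<exists>\<alpha> \<beta>. h = \<alpha> * q + \<beta> * f))"
  have "q \<noteq> 0" using irr by (metis not_irreducible_zero)
  moreover have "q = 1 * q + 0 * f" by simp
  ultimately have "J q" unfolding J_def using q_in by blast
  then obtain h where h: "J h" and min: "\<And>h'. J h' \<Longrightarrow> degree_in y h \<le> degree_in y h'"
    using ex_has_least_nat[of J q "degree_in y"] by blast
  then have h_in: "h \<in> polys_in (insert y V)" "h \<noteq> 0" by (auto simp: J_def)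
  from h obtain \<alpha> \<beta> where h_eq: "h = \<alpha> * q + \<beta> * f" by (auto simp: J_def)
  have divides: "\<exists>c s. c \<in> polys_in V \<and> c \<noteq> 0 \<and> s \<in> polys_in (insert y V) \<and> c * p = h * s"
    if p: "p \<in> polys_in (insert y V)" "\<exists>\<gamma> \<delta>. p = \<gamma> * q + \<delta> * f" for p
  proof -
    obtain c s where cs: "c \<in> polys_in V" "c \<noteq> 0" "s \<in> polys_in (insert y V)"
      "c * p - h * s = 0 \<or> degree_in y (c * p - h * s) < degree_in y h"
      using pseudo_division[OF y h_in p(1)] by blast
    from p(2) obtain \<gamma> \<delta> where "p = \<gamma> * q + \<delta> * f" by blast
    then have "c * p - h * s = (c * \<gamma> - s * \<alpha>) * q + (c * \<delta> - s * \<beta>) * f"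
      by (simp add: h_eq algebra_simps)
    moreover have "c \<in> polys_in (insert y V)" by (rule polys_in_mono[OF _ cs(1)]) auto
    then have "c * p - h * s \<in> polys_in (insert y V)"
      using cs(3) p(1) h_in by blast
    ultimately have "c * p - h * s = 0"
      using cs(4) min[of "c * p - h * s"] unfolding J_def by fastforce
    with cs show ?thesis by auto
  qed
  have "\<exists>\<gamma> \<delta>. q = \<gamma> * q + \<delta> * f" by (intro exI[of _ 1] exI[of _ 0]) simp
  from divides[OF q_in this] obtain c s where cs: "c \<in> polys_in V" "c \<noteq> 0"
    "s \<in> polys_in (insert y V)" "c * q = h * s" by blast
  have "\<exists>\<gamma> \<delta>. f = \<gamma> * q + \<delta> * f" by (intro exI[of _ 0] exI[of _ 1]) simp
  from divides[OF f this] obtain c2 s2 where cs2: "c2 \<in> polys_in V" "c2 \<noteq> 0" "c2 * f = h * s2" by blast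
  from split_content[OF cs(2,1) h_in(1) cs(3,4)] obtain c1 h' s'
    where hs: "c1 \<in> polys_in V" "c1 \<noteq> 0" "h = c1 * h'" "q = h' * s'" by blast
  from irr hs(4) have "h' dvd 1 \<or> s' dvd 1" by (rule irreducibleD)
  then show "q dvd f"
  proof
    assume "s' dvd 1"
    then have "q dvd h'" using hs(4) dvd_mult_unit_cancel[of s' q h'] by (simp add: mult.commute)
    then have "q dvd c2 * f" by (simp add: cs2(3) hs(3))
    then show ?thesis using dvd_cancel_content cs2 f by blast
  next
    assume h': "h' dvd 1"
    \<comment> \<open>The Bezout relation for \<open>h\<close>, multiplied by \<open>g\<close>: both
      summands are multiples of \<open>q\<close>.\<close>
    have "h * g = \<alpha> * g * q + \<beta> * (f * g)" by (simp add: h_eq algebra_simps)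
    then have "q dvd h * g" using dvd by (simp add: dvd_add)
    then have "q dvd h' * (c1 * g)" by (simp add: hs(3) mult_ac)
    then have "q dvd c1 * g" by (rule dvd_mult_unit_cancel[OF h'])
    then have "q dvd g" using dvd_cancel_content hs g by blast
    with not_dvd show ?thesis by blast
  qed
qed

end

text \<open>Primality relative to \<open>polys_in V\<close> is what allows induction on
  \<open>V\<close>. Either \<open>q\<close> avoids the new variable and Gauss's argument lifts its
  primality, or its degree there is positive and the Euclidean argument applies.\<close>

lemma irreducible_imp_prime_in:
  fixes q :: "('v::linorder, 'k::field) mpol"
  assumes "finite V" "q \<in> polys_in V" "irreducible q"
  shows "prime_in V q"
  using assms
proof (induction V arbitrary: q)
  case empty
  then have "q dvd 1" using polys_in_empty[of q] by (auto simp: unit_iff_cst)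
  with empty show ?case by (simp add: irreducible_not_unit)
next
  case (insert y V)
  show ?case
  proof (cases "degree_in y q = 0")
    case True
    have "q \<in> polys_in V"
      unfolding polys_in_iff_degree_in
    proof safe
      fix z assume "z \<notin> V"
      then show "degree_in z q = 0"
        using True insert.prems(1) by (cases "z = y") (auto simp: polys_in_iff_degree_in)
    qed
    with insert show ?thesis by (intro prime_in_insert) auto
  next
    case False
    with insert show ?thesis by (intro prime_in_insert_positive_degree) auto
  qed
qed

theorem irreducible_imp_prime_elem:
  fixes q :: "('v::linorder, 'k::field) mpol"
  assumes "irreducible q"
  shows "prime_elem q"
  unfolding prime_elem_def
proof (intro conjI allI impI)
  fix f g :: "('v, 'k) mpol" assume "q dvd f * g"
  obtain A B C where "finite A" "q \<in> polys_in A" "finite B" "f \<in> polys_in B" "finite C" "g \<in> polys_in C"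
    by (metis polys_in_finite_vars)
  moreover from this have "q \<in> polys_in (A \<union> B \<union> C)" "f \<in> polys_in (A \<union> B \<union> C)" "g \<in> polys_in (A \<union> B \<union> C)"
    by (auto elim!: polys_in_mono[rotated])
  ultimately show "q dvd f \<or> q dvd g"
    using irreducible_imp_prime_in[of "A \<union> B \<union> C" q] assms \<open>q dvd f * g\<close> by (auto simp: prime_in_def)
qed (use assms irreducible_not_unit in auto)

lemmas irreducible_dvd_multD = irreducible_imp_prime_elem[THEN prime_elem_dvd_multD]

lemma irreducible_dvd_powerD:
  fixes q :: "('v::linorder, 'k::field) mpol"
  shows "irreducible q \<Longrightarrow> q dvd a ^ k \<Longrightarrow> q dvd a"
  using irreducible_imp_prime_elem prime_elem_dvd_power by blast

lemma irreducible_dvd_prodD: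
  fixes q :: "('v::linorder, 'k::field) mpol"
  assumes "irreducible q" "q dvd prod f A"
  shows "\<exists>i\<in>A. q dvd f i"
  using assms
proof (induction A rule: infinite_finite_induct)
  case (insert i A)
  then show ?case using irreducible_dvd_multD[of q "f i" "prod f A"] by auto
qed (auto dest: irreducible_not_unit)

section \<open>Coprimality, squarefree and reduced polynomials\<close>

text \<open>Coprimality is expressed by irreducible factors instead of a gcd; since irreducibles are
  prime, it passes to products and powers.\<close>

definition no_common_factor :: "'a::comm_semiring_1 \<Rightarrow> 'a \<Rightarrow> bool" where
  "no_common_factor a b \<longleftrightarrow> (\<forall>q. irreducible q \<longrightarrow> q dvd a \<longrightarrow> \<not> q dvd b)"

lemma no_common_factor_commute: "no_common_factor a b \<longleftrightarrow> no_common_factor b a"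
  by (auto simp: no_common_factor_def)

lemma no_common_factor_mult_iff:
  fixes a b c :: "('v::linorder, 'k::field) mpol"
  shows "no_common_factor a (b * c) \<longleftrightarrow> no_common_factor a b \<and> no_common_factor a c"
  unfolding no_common_factor_def using irreducible_dvd_multD by (metis dvd_mult dvd_mult2)

lemma no_common_factor_prod:
  fixes a :: "('v::linorder, 'k::field) mpol"
  shows "(\<And>i. i \<in> A \<Longrightarrow> no_common_factor a (f i)) \<Longrightarrow> no_common_factor a (prod f A)"
  unfolding no_common_factor_def using irreducible_dvd_prodD by blast

lemma no_common_factor_power:
  fixes a :: "('v::linorder, 'k::field) mpol"
  shows "no_common_factor a b \<Longrightarrow> no_common_factor a (b ^ k)"
  unfolding no_common_factor_def using irreducible_dvd_powerD by blast

text \<open>The irreducible factors of \<open>a\<close> are split off from \<open>c\<close> one at a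
  time.\<close>

lemma no_common_factor_dvd_multD:
  fixes a b c :: "('v::linorder, 'k::field) mpol"
  assumes "no_common_factor a b" "a \<noteq> 0" "a dvd b * c"
  shows "a dvd c"
  using assms(2,1,3)
proof (induction a arbitrary: c rule: irreducible_factor_induct)
  case (unit u)
  then show ?case by (meson dvd_trans one_dvd)
next
  case (irreducible q a)
  have q: "q \<noteq> 0" "\<not> q dvd b"
    using irreducible.hyps(1) irreducible.prems(1) by (auto simp: no_common_factor_def)
  have ncf: "no_common_factor a b"
    using irreducible.prems(1) by (auto simp: no_common_factor_def)
  have "a dvd b * c" using irreducible.prems(2) by (metis dvd_mult_right)
  from irreducible.IH[OF ncf this] obtain c' where c': "c = a * c'" by (rule dvdE)
  with irreducible.prems(2) have "a * q dvd a * (b * c')" by (simp add: mult_ac)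
  then have "q dvd b * c'" using irreducible.hyps(2) by simp
  with irreducible_dvd_multD[OF irreducible.hyps(1)] q have "q dvd c'" by blast
  then show ?case by (simp add: c' mult.commute)
qed

lemma prod_dvd_of_no_common_factor:
  fixes f :: "'i \<Rightarrow> ('v::linorder, 'k::field) mpol"
  assumes "finite A" "\<And>i. i \<in> A \<Longrightarrow> f i dvd h" "\<And>i. i \<in> A \<Longrightarrow> f i \<noteq> 0"
    and "\<And>i j. i \<in> A \<Longrightarrow> j \<in> A \<Longrightarrow> i \<noteq> j \<Longrightarrow> no_common_factor (f i) (f j)"
  shows "prod f A dvd h"
  using assms
proof (induction A)
  case (insert i A)
  then have "prod f A dvd h" by blast
  then obtain h' where h': "h = prod f A * h'" by (rule dvdE)
  have "no_common_factor (f i) (prod f A)"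
    using insert by (intro no_common_factor_prod) auto
  then have "f i dvd h'"
    using insert.prems(1,2)[of i] h' by (intro no_common_factor_dvd_multD[of "f i" "prod f A" h']) auto
  then show ?case using insert.hyps h' by (simp add: mult.commute mult_dvd_mono)
qed auto

section \<open>Squarefree and reduced polynomials\<close>

lemma squarefree_iff_irreducible:
  fixes f :: "('v::linorder, 'k::field) mpol"
  assumes "f \<noteq> 0"
  shows "squarefree f \<longleftrightarrow> (\<forall>q. irreducible q \<longrightarrow> \<not> q ^ 2 dvd f)"
proof safe
  fix q assume "squarefree f" "irreducible q" "q ^ 2 dvd f"
  then show False using squarefreeD irreducible_not_unit by blast
next
  assume *: "\<forall>q. irreducible q \<longrightarrow> \<not> q ^ 2 dvd f"
  show "squarefree f"
  proof (rule squarefreeI, rule ccontr)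
    fix x assume x: "x ^ 2 dvd f" "\<not> x dvd 1"
    with assms have "x \<noteq> 0" by auto
    then obtain q where "irreducible q" "q dvd x" using x(2) by (rule ex_irreducible_dvd)
    with x(1) * show False by (meson dvd_power_same dvd_trans)
  qed
qed

lemma squarefree_mult_no_common_factor:
  fixes a b :: "('v::linorder, 'k::field) mpol"
  assumes "squarefree a" "squarefree b" "no_common_factor a b"
  shows "squarefree (a * b)"
proof -
  have nz: "a \<noteq> 0" "b \<noteq> 0" using assms(1,2) by auto
  \<comment> \<open>If \<open>q\<close> does not divide \<open>b\<close>, then \<open>q ^ 2\<close>
    is coprime to \<open>b\<close> and already divides \<open>a\<close>. The variables are
    generalised so that the roles of the two factors can be exchanged.\<close>
  have aux: False if ab: "squarefree a" "a \<noteq> 0" and q: "irreducible q" "q ^ 2 dvd a * b" "\<not> q dvd b" for a b q :: "('v, 'k) mpol"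
  proof -
    from q(1) have "q \<noteq> 0" by auto
    have "no_common_factor b (q ^ 2)"
      unfolding no_common_factor_def
    proof safe
      fix p assume p: "irreducible p" "p dvd b" "p dvd q ^ 2"
      then have "p dvd q" using irreducible_dvd_powerD[OF p(1,3)] by simp
      then have "q dvd p" using irreducible_dvd_irreducible p(1) q(1) by blast
      with p(2) q(3) show False by (blast intro: dvd_trans)
    qed
    then have "q ^ 2 dvd a"
      using q(2) \<open>q \<noteq> 0\<close>
      by (intro no_common_factor_dvd_multD[of "q ^ 2" b a]) (auto simp: no_common_factor_commute mult.commute)
    then show False using ab q(1) squarefree_iff_irreducible by blast
  qed
  have "\<not> q ^ 2 dvd a * b" if q: "irreducible q" for q
  proof
    assume dvd: "q ^ 2 dvd a * b"
    then have "q ^ 2 dvd b * a" by (simp only: mult.commute)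
    with dvd aux[of a q b] aux[of b q a] assms nz q show False
      unfolding no_common_factor_def by blast
  qed
  with nz show ?thesis by (subst squarefree_iff_irreducible) auto
qed

lemma squarefree_prod_no_common_factor:
  fixes f :: "'i \<Rightarrow> ('v::linorder, 'k::field) mpol"
  assumes "finite A" "\<And>i. i \<in> A \<Longrightarrow> squarefree (f i)"
    and "\<And>i j. i \<in> A \<Longrightarrow> j \<in> A \<Longrightarrow> i \<noteq> j \<Longrightarrow> no_common_factor (f i) (f j)"
  shows "squarefree (prod f A)"
  using assms
proof (induction A)
  case (insert i A)
  have "no_common_factor (f i) (prod f A)"
    using insert by (intro no_common_factor_prod) auto
  with insert show ?case by (auto intro!: squarefree_mult_no_common_factor)
qed (auto simp: squarefree_def power2_eq_square dest: dvd_mult_left)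

lemma squarefree_imp_no_common_factor:
  assumes "squarefree (a * b)"
  shows "no_common_factor a b"
  unfolding no_common_factor_def
proof safe
  fix q assume q: "irreducible q" "q dvd a" "q dvd b"
  then have "q ^ 2 dvd a * b" by (simp add: power2_eq_square mult_dvd_mono)
  with assms q(1) show False using squarefreeD irreducible_not_unit by blast
qed

lemma squarefree_cst_mult:
  fixes f :: "('v::linorder, 'k::field) mpol"
  assumes "squarefree f" "c \<noteq> 0"
  shows "squarefree (cst c * f)"
proof (rule squarefreeI)
  fix x assume "x ^ 2 dvd cst c * f"
  moreover have "cst c dvd (1 :: ('v, 'k) mpol)" using assms(2) by (auto simp: unit_iff_cst)
  ultimately have "x ^ 2 dvd f" using dvd_mult_unit_cancel by blast
  with assms(1) show "x dvd 1" by (rule squarefreeD)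
qed

lemma squarefree_factorisation:
  fixes f :: "('v::linorder, 'k::field) mpol"
  assumes "squarefree f"
  shows "\<exists>P c. finite P \<and> (\<forall>p\<in>P. irreducible p) \<and>
    (\<forall>p\<in>P. \<forall>p'\<in>P. p dvd p' \<longrightarrow> p = p') \<and> c \<noteq> 0 \<and> f = cst c * \<Prod>P"
proof -
  have "f \<noteq> 0" using assms by auto
  then show ?thesis using assms
  proof (induction f rule: irreducible_factor_induct)
    case (unit u)
    then obtain c where "c \<noteq> 0" "u = cst c" by (auto simp: unit_iff_cst)
    then show ?case by (intro exI[of _ "{}"] exI[of _ c]) auto
  next
    case (irreducible q f)
    have "squarefree f" using irreducible.prems by (metis dvd_mult squarefree_def)
    with irreducible.IH obtain P c where P: "finite P" "\<forall>p\<in>P. irreducible p"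
      "\<forall>p\<in>P. \<forall>p'\<in>P. p dvd p' \<longrightarrow> p = p'" "c \<noteq> 0" "f = cst c * \<Prod>P" by blast
    have not_dvd: "\<not> q dvd p" if "p \<in> P" for p
    proof
      assume "q dvd p"
      moreover have "p dvd f" using that P(1) by (simp add: P(5) dvd_prod_eqI)
      ultimately show False
        using squarefree_imp_no_common_factor[OF irreducible.prems] irreducible.hyps(1)
        by (auto simp: no_common_factor_def intro: dvd_trans)
    qed
    have not_dvd': "\<not> p dvd q" if "p \<in> P" for p
    proof
      assume "p dvd q"
      moreover have "irreducible p" using that P(2) by blast
      ultimately have "q dvd p" using irreducible.hyps(1) by (intro irreducible_dvd_irreducible[of p q])
      with not_dvd[OF that] show False by blast
    qed
    have q_notin: "q \<notin> P" using not_dvd[of q] by auto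
    have "\<forall>p\<in>insert q P. \<forall>p'\<in>insert q P. p dvd p' \<longrightarrow> p = p'"
      "q * f = cst c * \<Prod>(insert q P)"
      using P(1,3,5) not_dvd not_dvd' q_notin by (simp_all add: mult_ac)
    with P irreducible.hyps(1) show ?case
      by (intro exI[of _ "insert q P"] exI[of _ c]) simp
  qed
qed

lemma is_reduced_ofI:
  fixes f g :: "(nat, 'k::field) mpol"
  assumes "squarefree g" "g dvd f" and irr: "\<And>q. irreducible q \<Longrightarrow> q dvd f \<Longrightarrow> q dvd g"
  shows "is_reduced_of f g"
proof -
  obtain P c where P: "finite P" "\<forall>p\<in>P. irreducible p" "\<forall>p\<in>P. \<forall>p'\<in>P. p dvd p' \<longrightarrow> p = p'"
    "c \<noteq> 0" "g = cst c * \<Prod>P"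
    using squarefree_factorisation[OF assms(1)] by blast
  have "p dvd f" if "p \<in> P" for p
    using that P(1) assms(2) by (auto simp: P(5) dvd_prod_eqI intro: dvd_trans)
  moreover have "\<exists>!p. p \<in> P \<and> p dvd q \<and> q dvd p" if q: "irreducible q" "q dvd f" for q
  proof -
    have "q dvd cst c * \<Prod>P" using irr[OF q] P(5) by simp
    moreover have "cst c dvd (1 :: (nat, 'k) mpol)" using P(4) by (auto simp: unit_iff_cst)
    ultimately have "q dvd \<Prod>P" using dvd_mult_unit_cancel by blast
    then obtain p where p: "p \<in> P" "q dvd p" using irreducible_dvd_prodD[OF q(1)] by blast
    then have "p dvd q" using irreducible_dvd_irreducible q(1) P(2) by blast
    with p P(3) show ?thesis by (blast intro: dvd_trans)
  qed
  ultimately show ?thesis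
    unfolding is_reduced_of_def using P(1,2,4,5) by (intro exI[of _ P] exI[of _ c]) simp
qed

text \<open>Association is a bijection between two systems of representatives, and units are
  constants. Hence a claim about every reduced polynomial can be proved for \<open>f12_red\<close>
  alone.\<close>

lemma is_reduced_of_unique:
  fixes f g g' :: "(nat, 'k::field) mpol"
  assumes "is_reduced_of f g" "is_reduced_of f g'"
  shows "\<exists>c. c \<noteq> 0 \<and> g' = cst c * g"
proof -
  obtain P c where P: "finite P" "\<forall>p\<in>P. irreducible p \<and> p dvd f"
    "\<forall>q. irreducible q \<and> q dvd f \<longrightarrow> (\<exists>!p. p \<in> P \<and> p dvd q \<and> q dvd p)" "c \<noteq> 0" "g = cst c * \<Prod>P"
    using assms(1) unfolding is_reduced_of_def by blast
  obtain P' c' where P': "finite P'" "\<forall>p\<in>P'. irreducible p \<and> p dvd f"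
    "\<forall>q. irreducible q \<and> q dvd f \<longrightarrow> (\<exists>!p. p \<in> P' \<and> p dvd q \<and> q dvd p)" "c' \<noteq> 0" "g' = cst c' * \<Prod>P'"
    using assms(2) unfolding is_reduced_of_def by blast
  have "\<forall>p\<in>P. \<exists>p'. p' \<in> P' \<and> p' dvd p \<and> p dvd p'"
  proof
    fix p assume "p \<in> P"
    with P(2) have "irreducible p \<and> p dvd f" by blast
    with P'(3) show "\<exists>p'. p' \<in> P' \<and> p' dvd p \<and> p dvd p'" by blast
  qed
  then obtain h where h: "\<forall>p\<in>P. h p \<in> P' \<and> h p dvd p \<and> p dvd h p" by metis
  have "bij_betw h P P'"
    unfolding bij_betw_def
  proof safe
    show "inj_on h P"
    proof (rule inj_onI)
      fix p p' assume pp: "p \<in> P" "p' \<in> P" "h p = h p'"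
      then have "p dvd p' \<and> p' dvd p" using h by (metis dvd_trans)
      with pp P(2,3) show "p = p'" by (metis dvd_refl)
    qed
    show "h p \<in> P'" if "p \<in> P" for p using h that by blast
    show "p' \<in> h ` P" if p': "p' \<in> P'" for p'
    proof -
      obtain p where p: "p \<in> P" "p dvd p'" "p' dvd p" using p' P'(2) P(3) by metis
      then have "h p dvd p'" "p' dvd h p" using h by (meson dvd_trans)+
      then have "h p = p'" using P'(2,3) p' h p(1) by (metis dvd_refl)
      with p(1) show ?thesis by blast
    qed
  qed
  moreover have "\<exists>d. d \<noteq> 0 \<and> h p = cst d * p" if "p \<in> P" for p
  proof -
    from h that obtain s t where st: "h p = p * s" "p = h p * t" by (meson dvdE)
    have "irreducible p" using P(2) that by blast
    then have "p \<noteq> 0" by (metis not_irreducible_zero)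
    have "p * (s * t) = p * 1" using st by (metis mult.assoc mult.right_neutral)
    then have "s * t = 1" using \<open>p \<noteq> 0\<close> by (metis mult_cancel_left)
    then have "s dvd 1" by (metis dvd_triv_left)
    with st(1) show ?thesis by (auto simp: unit_iff_cst mult.commute)
  qed
  then obtain d where d: "\<forall>p\<in>P. d p \<noteq> 0 \<and> h p = cst (d p) * p" by metis
  ultimately have "\<Prod>P' = (\<Prod>p\<in>P. cst (d p) * p)"
    using prod.reindex_bij_betw[of h P P' "\<lambda>x. x"] d by simp
  then have eq: "\<Prod>P' = cst (\<Prod>p\<in>P. d p) * \<Prod>P" by (simp add: prod.distrib cst_prod)
  define D where "D = (\<Prod>p\<in>P. d p)"
  have "g' = cst (c' * D / c) * g"
    using P(4) unfolding P(5) P'(5) eq by (simp flip: D_def cst_mult mult.assoc)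
  moreover have "c' * D / c \<noteq> 0" using P(1,4) P'(4) d by (simp add: D_def)
  ultimately show ?thesis by blast
qed

section \<open>Logarithmic derivations\<close>

text \<open>\<open>xder i\<close> is $x_i\,\partial_{x_i}$.\<close>

definition xder :: "'v \<Rightarrow> ('v, 'k::semiring_1) mpol \<Rightarrow> ('v, 'k) mpol" where
  "xder i = Poly_Mapping.mapp (\<lambda>t c. of_nat (Poly_Mapping.lookup t i) * c)"

lemma lookup_xder:
  "Poly_Mapping.lookup (xder i p) t = of_nat (Poly_Mapping.lookup t i) * Poly_Mapping.lookup p t"
  by (auto simp: xder_def lookup_mapp when_def in_keys_iff)

lemma xder_0 [simp]: "xder i 0 = 0"
  by (rule poly_mapping_eqI) (simp add: lookup_xder)

lemma xder_add: "xder i (p + q) = xder i p + xder i q"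
  by (rule poly_mapping_eqI) (simp add: lookup_xder lookup_add algebra_simps)

lemma xder_sum: "xder i (sum f A) = (\<Sum>x\<in>A. xder i (f x))"
  by (induction A rule: infinite_finite_induct) (auto simp: xder_add)

lemma xder_single: "xder i (Poly_Mapping.single t c) =
    Poly_Mapping.single t (of_nat (Poly_Mapping.lookup t i) * c)"
  by (rule poly_mapping_eqI) (simp add: lookup_xder lookup_single when_def)

lemma xder_cst [simp]: "xder i (cst c) = 0"
  by (simp add: cst_def xder_single)

lemma xder_X: "xder i (X j) = (if i = j then X j else 0)"
  by (simp add: X_def xder_single lookup_single when_def)

lemma xder_mult:
  fixes p q :: "('v, 'k::comm_semiring_1) mpol"
  shows "xder i (p * q) = p * xder i q + q * xder i p"
proof -
  have single: "xder i (Poly_Mapping.single s a * Poly_Mapping.single t b) =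
      Poly_Mapping.single s a * xder i (Poly_Mapping.single t b) +
      Poly_Mapping.single t b * xder i (Poly_Mapping.single s a)"
    for s t :: "'v \<Rightarrow>\<^sub>0 nat" and a b :: 'k
    by (simp add: mult_single xder_single lookup_add add.commute algebra_simps flip: single_add)
  define P where "P = (\<Sum>t\<in>Poly_Mapping.keys p. Poly_Mapping.single t (Poly_Mapping.lookup p t))"
  define Q where "Q = (\<Sum>t\<in>Poly_Mapping.keys q. Poly_Mapping.single t (Poly_Mapping.lookup q t))"
  have "xder i (P * Q) = P * xder i Q + Q * xder i P"
    unfolding P_def Q_def xder_sum sum_product single sum.distrib
    by (subst (3) sum.swap) simp
  moreover have "P = p" "Q = q" by (simp_all add: P_def Q_def flip: poly_mapping_sum_single)
  ultimately show ?thesis by simp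
qed

lemma polys_in_xder: "p \<in> polys_in V \<Longrightarrow> xder i p \<in> polys_in V"
  using keys_mapp_subset[of _ p] by (fastforce simp: polys_in_def xder_def)

text \<open>The derivation with coefficients \<open>g i * X i\<close>, the general shape of one that
  is logarithmic along all coordinate hyperplanes.\<close>

definition lder :: "nat \<Rightarrow> (nat \<Rightarrow> (nat, 'k::comm_semiring_1) mpol) \<Rightarrow> (nat, 'k) mpol \<Rightarrow> (nat, 'k) mpol" where
  "lder n g p = (\<Sum>i\<in>{0..n}. g i * xder i p)"

lemma lder_cst [simp]: "lder n g (cst c) = 0"
  by (simp add: lder_def)

lemma lder_1 [simp]: "lder n g 1 = 0"
  using lder_cst[of n g 1] by (simp del: lder_cst)

lemma lder_0 [simp]: "lder n g 0 = 0"
  by (simp add: lder_def)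

lemma lder_add: "lder n g (p + q) = lder n g p + lder n g q"
  by (simp add: lder_def xder_add algebra_simps sum.distrib)

lemma lder_sum: "lder n g (sum f A) = (\<Sum>x\<in>A. lder n g (f x))"
  by (induction A rule: infinite_finite_induct) (auto simp: lder_add)

lemma lder_mult: "lder n g (p * q) = p * lder n g q + q * lder n g p"
  by (simp add: lder_def xder_mult algebra_simps sum.distrib sum_distrib_left)

lemma lder_cst_mult: "lder n g (cst c * p) = cst c * lder n g p"
  by (simp add: lder_mult)

lemma lder_X: "i \<le> n \<Longrightarrow> lder n g (X i) = g i * X i"
  by (simp add: lder_def xder_X if_distrib cong: if_cong)

text \<open>Being logarithmic along \<open>p\<close> means that \<open>p\<close> is an eigenvector
  with a polynomial eigenvalue. That eigenvalues add turns the condition on a product into a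
  sum.\<close>

lemma lder_eigen_mult:
  "lder n g p = a * p \<Longrightarrow> lder n g q = b * q \<Longrightarrow> lder n g (p * q) = (a + b) * (p * q)"
  by (simp add: lder_mult algebra_simps)

lemma lder_eigen_prod:
  "(\<And>x. x \<in> A \<Longrightarrow> lder n g (f x) = e x * f x) \<Longrightarrow> lder n g (prod f A) = sum e A * prod f A"
proof (induction A rule: infinite_finite_induct)
  case (insert x A)
  then show ?case by (simp add: lder_eigen_mult[of _ _ _ "e x" _ "sum e A"])
qed auto

lemma lder_eigen_power:
  "lder n g p = a * p \<Longrightarrow> lder n g (p ^ k) = of_nat k * a * p ^ k"
proof (induction k)
  case (Suc k)
  then show ?case by (simp add: lder_eigen_mult[of _ _ _ a _ "of_nat k * a"] algebra_simps)
qed auto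

lemma lder_in_Der:
  fixes g :: "nat \<Rightarrow> (nat, 'k::field) mpol"
  assumes "\<And>i. i \<le> n \<Longrightarrow> g i \<in> R n"
  shows "lder n g \<in> Der n"
proof -
  have "lder n g p \<in> R n" if "p \<in> R n" for p
    unfolding lder_def R_eq_polys_in
    using assms that by (intro polys_in_sum polys_in_mult polys_in_xder) (auto simp: R_eq_polys_in)
  then show ?thesis by (auto simp: Der_def lder_add lder_cst_mult lder_mult)
qed

lemma Der_eqI:
  fixes \<delta> \<delta>' :: "(nat, 'k::field) mpol \<Rightarrow> (nat, 'k) mpol"
  assumes "\<delta> \<in> Der n" "\<delta>' \<in> Der n" "\<And>i. i \<le> n \<Longrightarrow> \<delta> (X i) = \<delta>' (X i)" "p \<in> R n"
  shows "\<delta> p = \<delta>' p"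
proof -
  \<comment> \<open>Linearity reduces constants to 1, where the Leibniz rule gives \<delta> 1 =
    \<delta> 1 + \<delta> 1.\<close>
  have const: "\<delta> (cst c) = 0" if "\<delta> \<in> Der n" for \<delta> and c :: 'k
  proof -
    have R: "1 \<in> R n" by (simp add: R_eq_polys_in)
    then have "\<delta> (1 * 1) = 1 * \<delta> 1 + 1 * \<delta> 1" using that unfolding Der_def by blast
    then have "\<delta> 1 = \<delta> 1 + \<delta> 1" by (simp only: mult_1_left)
    then have "\<delta> 1 = 0" by (metis add_0_right add_left_cancel)
    moreover have "\<delta> (cst c * 1) = cst c * \<delta> 1" using that R unfolding Der_def by blast
    ultimately show ?thesis by simp
  qed
  show ?thesis
    using assms(4) unfolding R_eq_polys_in
  proof (induction p rule: polys_in_induct)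
    case (cst c)
    show ?case by (simp add: const[OF assms(1)] const[OF assms(2)])
  next
    case (X v)
    then show ?case using assms(3) by simp
  next
    case (add p q)
    then show ?case using assms(1,2) by (simp add: Der_def R_eq_polys_in)
  next
    case (mult p q)
    then show ?case using assms(1,2) by (simp add: Der_def R_eq_polys_in)
  qed
qed

text \<open>The Leibniz rule makes \<open>a\<close> a divisor of \<open>b * \<delta> a\<close>, and
  \<open>b\<close> can be cancelled. So a derivation that kills a squarefree product is logarithmic
  along each factor.\<close>

lemma Der_dvd:
  fixes \<delta> :: "(nat, 'k::field) mpol \<Rightarrow> (nat, 'k) mpol"
  assumes "\<delta> \<in> Der n" "a \<in> R n" "b \<in> R n" "\<delta> (a * b) = 0" "no_common_factor a b" "a \<noteq> 0"
  shows "a dvd \<delta> a"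
proof -
  have "a * \<delta> b + b * \<delta> a = 0" using assms(1-4) by (simp add: Der_def)
  then have "b * \<delta> a = a * (- \<delta> b)" by (simp add: eq_neg_iff_add_eq_0 add.commute)
  then have "a dvd b * \<delta> a" by simp
  then show ?thesis using assms no_common_factor_dvd_multD by blast
qed

lemma Der0_cst_mult:
  fixes f :: "(nat, 'k::field) mpol"
  assumes "f \<in> R n" "c \<noteq> 0"
  shows "Der0 n (cst c * f) = Der0 n f"
  using assms by (auto simp: Der0_def Der_def)

section \<open>Homogeneous polynomials\<close>

lemma homogeneous_0 [simp]: "homogeneous d 0"
  by (simp add: homogeneous_def)

lemma homogeneous_cst [simp]: "homogeneous 0 (cst c)"
  by (simp add: homogeneous_def cst_def)

lemma homogeneous_X [simp]: "homogeneous 1 (X i :: ('v, 'k::zero_neq_one) mpol)"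
  by (simp add: homogeneous_def X_def)

lemma homogeneous_1 [simp]: "homogeneous 0 (1 :: ('v, 'k::zero_neq_one) mpol)"
  by (simp add: homogeneous_def)

lemma homogeneous_add:
  fixes p q :: "('v, 'k::monoid_add) mpol"
  shows "homogeneous d p \<Longrightarrow> homogeneous d q \<Longrightarrow> homogeneous d (p + q)"
  using keys_add[of p q] by (auto simp: homogeneous_def)

lemma homogeneous_uminus:
  fixes p :: "('v, 'k::ab_group_add) mpol"
  shows "homogeneous d p \<Longrightarrow> homogeneous d (- p)"
  by (auto simp: homogeneous_def in_keys_iff)

lemma homogeneous_sum:
  fixes f :: "'a \<Rightarrow> ('v, 'k::comm_monoid_add) mpol"
  shows "(\<And>i. i \<in> A \<Longrightarrow> homogeneous d (f i)) \<Longrightarrow> homogeneous d (sum f A)"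
  by (induction A rule: infinite_finite_induct) (auto intro: homogeneous_add)

lemma homogeneous_mult:
  fixes p q :: "('v, 'k::semiring_0) mpol"
  assumes "homogeneous d p" "homogeneous e q"
  shows "homogeneous (d + e) (p * q)"
  unfolding homogeneous_def
proof
  fix t assume "t \<in> Poly_Mapping.keys (p * q)"
  then obtain a b where ab: "t = a + b" "a \<in> Poly_Mapping.keys p" "b \<in> Poly_Mapping.keys q"
    using keys_mult[of p q] by auto
  have "(\<Sum>v\<in>Poly_Mapping.keys t. Poly_Mapping.lookup t v) =
      (\<Sum>v\<in>Poly_Mapping.keys a. Poly_Mapping.lookup a v) + (\<Sum>v\<in>Poly_Mapping.keys b. Poly_Mapping.lookup b v)"
    unfolding ab(1) using setsum_keys_plus_distrib[of "\<lambda>_ x. x" a b] by simp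
  with ab assms show "(\<Sum>v\<in>Poly_Mapping.keys t. Poly_Mapping.lookup t v) = d + e"
    by (simp add: homogeneous_def)
qed

lemma homogeneous_prod:
  fixes f :: "'a \<Rightarrow> ('v, 'k::comm_semiring_1) mpol"
  shows "(\<And>i. i \<in> A \<Longrightarrow> homogeneous (d i) (f i)) \<Longrightarrow> homogeneous (sum d A) (prod f A)"
  by (induction A rule: infinite_finite_induct) (auto intro: homogeneous_mult)

lemma homogeneous_power:
  fixes p :: "('v, 'k::comm_semiring_1) mpol"
  shows "homogeneous d p \<Longrightarrow> homogeneous (k * d) (p ^ k)"
  by (induction k) (auto intro: homogeneous_mult)

lemma homogeneous_cst_mult:
  fixes p :: "('v, 'k::comm_semiring_1) mpol"
  shows "homogeneous d p \<Longrightarrow> homogeneous d (cst c * p)"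
  using homogeneous_mult[of 0 "cst c" d p] by simp


section \<open>Weighted sums of the omitted products\<close>

lemma irreducible_X: "irreducible (X v :: ('v::linorder, 'k::field) mpol)"
proof -
  have deg: "degree_in v (X v :: ('v, 'k) mpol) = 1" by (simp add: upoly_X)
  show ?thesis
    unfolding irreducible_def
  proof (intro conjI allI impI)
    show "\<not> X v dvd (1 :: ('v, 'k) mpol)"
      using deg by (auto simp: unit_iff_cst)
  next
    fix a b :: "('v, 'k) mpol" assume ab: "X v = a * b"
    then have "a * b \<noteq> 0" by (metis X_nonzero)
    then have nz: "a \<noteq> 0" "b \<noteq> 0" by auto
    have unit: "c dvd 1" if "c \<in> polys_in {v}" "degree_in v c = 0" "c \<noteq> 0" for c :: "('v, 'k) mpol"
      using degree_in_sum_pos[of "{v}" c] that by auto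
    have "degree_in v a + degree_in v b = 1" using deg degree_in_mult[OF nz, of v] by (simp add: ab)
    then have "degree_in v a = 0 \<or> degree_in v b = 0" by auto
    moreover have "a * b \<in> polys_in {v}" by (simp flip: ab)
    then have "a \<in> polys_in {v}" "b \<in> polys_in {v}"
      using nz polys_in_multD[of a b] polys_in_multD[of b a] by (auto simp: mult.commute)
    ultimately show "a dvd 1 \<or> b dvd 1" using unit nz by blast
  qed simp
qed

lemma X_dvd_imp_eval_0:
  fixes f :: "('v, 'k::comm_semiring_1) mpol"
  assumes "X v dvd f" "x v = 0"
  shows "eval.subst x f = 0"
  using assms by (auto simp: eval.subst_mult)

lemma X_dvd_X_iff: "(X v :: ('v, 'k::comm_semiring_1) mpol) dvd X w \<longleftrightarrow> v = w"
  using X_dvd_imp_eval_0[of v "X w :: ('v, 'k) mpol" "\<lambda>u. if u = v then 0 else 1"]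
  by (auto split: if_splits)

lemma no_common_factor_X:
  fixes f :: "('v::linorder, 'k::field) mpol"
  assumes "\<not> X v dvd f"
  shows "no_common_factor f (X v)"
  unfolding no_common_factor_def
  using assms irreducible_dvd_irreducible[OF _ irreducible_X[of v]] by (metis dvd_trans)

lemma no_common_factor_polys_in:
  fixes f g :: "('v::linorder, 'k::field) mpol"
  assumes "f \<in> polys_in V" "g \<in> polys_in W" "V \<inter> W = {}" "f \<noteq> 0" "g \<noteq> 0"
  shows "no_common_factor f g"
  unfolding no_common_factor_def
proof safe
  fix q assume q: "irreducible q" "q dvd f" "q dvd g"
  then have "q \<in> polys_in V" "q \<in> polys_in W" using assms polys_in_dvd by blast+
  then have "q \<in> polys_in (V \<inter> W)" by (auto simp: polys_in_def)
  then have "q \<in> polys_in {}" using assms(3) by simp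
  moreover have "q \<noteq> 0" using q(1) by auto
  ultimately have "q dvd 1" using polys_in_empty[of q] by (auto simp: unit_iff_cst)
  with q(1) show False by (simp add: irreducible_not_unit)
qed

lemma no_common_factor_dvd: "no_common_factor a b \<Longrightarrow> c dvd b \<Longrightarrow> no_common_factor a c"
  unfolding no_common_factor_def by (blast intro: dvd_trans)

text \<open>In terms of y_i = x_i^(-r), this is the weighted sum of the y_i times the monomial that
  clears denominators. Weights 1 give \<open>p\<close> and \<open>q\<close>; weights constant on
  each of the two blocks give the members of the pencil.\<close>

definition wsum :: "nat \<Rightarrow> nat set \<Rightarrow> (nat \<Rightarrow> 'k) \<Rightarrow> (nat, 'k::field) mpol" where
  "wsum r C w = (\<Sum>i\<in>C. cst (w i) * omit_prod r C i)"

lemma omit_prod_polys_in: "omit_prod r C i \<in> polys_in C"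
  unfolding omit_prod_def by (intro polys_in_prod polys_in_power) auto

lemma wsum_polys_in: "wsum r C w \<in> polys_in C"
  unfolding wsum_def by (intro polys_in_sum polys_in_mult omit_prod_polys_in polys_in_cst)

lemma omit_prod_mult_X: "finite C \<Longrightarrow> i \<in> C \<Longrightarrow> X i ^ r * omit_prod r C i = (\<Prod>j\<in>C. X j ^ r)"
  by (simp add: omit_prod_def prod.remove)

lemma homogeneous_omit_prod:
  assumes "finite C" "i \<in> C"
  shows "homogeneous (r * (card C - 1)) (omit_prod r C i)"
proof -
  have "homogeneous (\<Sum>j\<in>C - {i}. r * 1) (omit_prod r C i)"
    unfolding omit_prod_def by (intro homogeneous_prod homogeneous_power homogeneous_X)
  then show ?thesis using assms by (simp add: mult.commute)
qed

lemma homogeneous_wsum: "finite C \<Longrightarrow> homogeneous (r * (card C - 1)) (wsum r C w)"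
  unfolding wsum_def by (intro homogeneous_sum homogeneous_cst_mult homogeneous_omit_prod)

text \<open>At the point with j-th coordinate 0 and all others 1, only the summand that omits x_j
  survives; r \<ge> 1 is what makes the others vanish.\<close>

lemma eval_wsum:
  assumes "finite C" "j \<in> C" "r \<ge> 1"
  shows "eval.subst (\<lambda>v. if v = j then 0 else 1) (wsum r C w) = w j"
proof -
  have "eval.subst (\<lambda>v. if v = j then 0 else 1) (omit_prod r C i) = (if i = j then 1 else 0 :: 'a)"
    if "i \<in> C" for i
  proof (cases "i = j")
    case False
    then have "(\<Prod>l\<in>C - {i}. (if l = j then 0 else 1 :: 'a) ^ r) = 0"
      using assms by (intro prod_zero) (auto intro!: bexI[of _ j])
    then show ?thesis using False by (simp add: omit_prod_def eval.subst_prod eval.subst_power)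
  next
    case True
    have "(\<Prod>l\<in>C - {i}. (if l = j then 0 else 1 :: 'a) ^ r) = 1"
      by (rule prod.neutral) (use True in auto)
    then show ?thesis using True by (simp add: omit_prod_def eval.subst_prod eval.subst_power)
  qed
  then have "eval.subst (\<lambda>v. if v = j then 0 else 1) (wsum r C w) = (\<Sum>i\<in>C. w i * (if i = j then 1 else 0))"
    unfolding wsum_def eval.subst_sum by (intro sum.cong) (simp_all add: eval.subst_mult)
  then show ?thesis using assms by (simp add: if_distrib cong: if_cong)
qed

lemma X_not_dvd_wsum: "finite C \<Longrightarrow> j \<in> C \<Longrightarrow> r \<ge> 1 \<Longrightarrow> w j \<noteq> 0 \<Longrightarrow> \<not> X j dvd wsum r C w"
  using eval_wsum[of C j r w] X_dvd_imp_eval_0[of j "wsum r C w" "\<lambda>v. if v = j then 0 else 1"] by auto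

lemma wsum_nonzero: "finite C \<Longrightarrow> C \<noteq> {} \<Longrightarrow> r \<ge> 1 \<Longrightarrow> (\<And>i. i \<in> C \<Longrightarrow> w i \<noteq> 0) \<Longrightarrow> wsum r C w \<noteq> 0"
  using X_not_dvd_wsum[of C _ r w] by (metis dvd_0_right ex_in_conv)

lemma no_common_factor_wsum_X:
  assumes "finite C" "C \<noteq> {}" "r \<ge> 1" "\<And>i. i \<in> C \<Longrightarrow> w i \<noteq> 0"
  shows "no_common_factor (wsum r C w) (X v)"
proof (rule no_common_factor_X, cases "v \<in> C")
  case True
  then show "\<not> X v dvd wsum r C w" using assms by (intro X_not_dvd_wsum) auto
next
  case False
  then show "\<not> X v dvd wsum r C w"
    using polys_in_dvd[of "X v" "wsum r C w" C] wsum_polys_in[of r C w] wsum_nonzero[of C r w] assms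
    by auto
qed

lemma lder_omit_prod:
  assumes "C \<subseteq> {0..n}" "i \<in> C"
  shows "lder n g (omit_prod r C i) = of_nat r * (sum g C - g i) * omit_prod r C i"
proof -
  have "lder n g (omit_prod r C i) = (\<Sum>j\<in>C - {i}. of_nat r * g j) * omit_prod r C i"
    unfolding omit_prod_def using assms
    by (intro lder_eigen_prod lder_eigen_power lder_X) auto
  also have "(\<Sum>j\<in>C - {i}. of_nat r * g j) = of_nat r * (sum g C - g i)"
    using assms finite_subset[OF assms(1)] by (simp add: sum_diff1 flip: sum_distrib_left)
  finally show ?thesis .
qed

lemma lder_wsum:
  assumes "C \<subseteq> {0..n}"
  shows "lder n g (wsum r C w) =
    of_nat r * (sum g C * wsum r C w - (\<Sum>i\<in>C. cst (w i) * (g i * omit_prod r C i)))"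
proof -
  have "lder n g (wsum r C w) = (\<Sum>i\<in>C. cst (w i) * (of_nat r * (sum g C - g i) * omit_prod r C i))"
    unfolding wsum_def lder_sum using assms
    by (intro sum.cong refl) (simp only: lder_cst_mult lder_omit_prod)
  also have "\<dots> = (\<Sum>i\<in>C. of_nat r * (sum g C * (cst (w i) * omit_prod r C i) - cst (w i) * (g i * omit_prod r C i)))"
    by (intro sum.cong refl) (simp add: algebra_simps)
  also have "\<dots> = of_nat r * (\<Sum>i\<in>C. sum g C * (cst (w i) * omit_prod r C i) - cst (w i) * (g i * omit_prod r C i))"
    by (rule sum_distrib_left[symmetric])
  finally show ?thesis
    by (simp only: wsum_def sum_distrib_left sum_subtractf)
qed

text \<open>A repeated factor would divide all \<open>omit_prod r C i\<close>, since $x_i\,\partial_{x_i}$ kills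
  the \<open>i\<close>-th summand only and multiplies the others by \<open>r\<close>.\<close>

lemma squarefree_wsum:
  fixes w :: "nat \<Rightarrow> 'k::field_char_0"
  assumes C: "finite C" "C \<noteq> {}" and r: "r \<ge> 1" and w: "\<And>i. i \<in> C \<Longrightarrow> w i \<noteq> 0"
  shows "squarefree (wsum r C w)"
proof (subst squarefree_iff_irreducible, rule wsum_nonzero[OF assms], safe)
  fix q assume q: "irreducible q" "q ^ 2 dvd wsum r C w"
  \<comment> \<open>\<open>lder\<close> sums over an initial segment of the variables, so
    \<open>C\<close> needs some upper bound.\<close>
  define n where "n = Max C"
  have Cn: "C \<subseteq> {0..n}" using C by (auto simp: n_def)
  from q(2) obtain s where s: "wsum r C w = q ^ 2 * s" by blast
  then have dvd: "q dvd wsum r C w" by (simp add: power2_eq_square mult.assoc)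
  have dvd_omit: "q dvd omit_prod r C i" if i: "i \<in> C" for i
  proof -
    define g where "g = (\<lambda>j. if j = i then 1 else 0 :: (nat, 'k) mpol)"
    have "lder n g (wsum r C w) = q * (q * lder n g s + s * (2 * lder n g q))"
      unfolding s by (simp add: lder_mult power2_eq_square algebra_simps)
    then have "q dvd lder n g (wsum r C w)" by simp
    moreover have "lder n g (wsum r C w) = of_nat r * (wsum r C w - cst (w i) * omit_prod r C i)"
      using i C by (simp add: lder_wsum[OF Cn] g_def if_distrib if_distribR cong: if_cong)
    ultimately have "q dvd cst (of_nat r) * (wsum r C w - cst (w i) * omit_prod r C i)"
      by (simp add: cst_of_nat)
    moreover have "cst (of_nat r) dvd (1 :: (nat, 'k) mpol)" using r by (auto simp: unit_iff_cst)
    ultimately have "q dvd wsum r C w - cst (w i) * omit_prod r C i"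
      using dvd_mult_unit_cancel by blast
    with dvd have "q dvd wsum r C w - (wsum r C w - cst (w i) * omit_prod r C i)" by (rule dvd_diff)
    then have "q dvd cst (w i) * omit_prod r C i" by simp
    moreover have "cst (w i) dvd (1 :: (nat, 'k) mpol)" using w[OF i] by (auto simp: unit_iff_cst)
    ultimately show ?thesis using dvd_mult_unit_cancel by blast
  qed
  \<comment> \<open>Applied to some \<open>i\<close> and then to the \<open>j\<close> so found, this
    makes \<open>q\<close> divide two different variables.\<close>
  have dvd_X: "\<exists>j\<in>C - {i}. q dvd X j" if "i \<in> C" for i
    using irreducible_dvd_prodD[OF q(1) dvd_omit[OF that, unfolded omit_prod_def]]
      irreducible_dvd_powerD[OF q(1)] by blast
  from C(2) obtain i where "i \<in> C" by blast
  from dvd_X[OF this] obtain j where j: "j \<in> C" "q dvd X j" by blast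
  from dvd_X[OF j(1)] obtain l where l: "l \<noteq> j" "q dvd X l" by blast
  have "X j dvd q" using irreducible_dvd_irreducible[OF q(1) irreducible_X j(2)] .
  with l have "X j dvd (X l :: (nat, 'k) mpol)" by (meson dvd_trans)
  with l(1) show False by (simp add: X_dvd_X_iff)
qed

section \<open>The logarithmic module of the pencil\<close>

text \<open>Multiplied by the product that omits x_i, the term \<open>c i * X i ^ r\<close> yields
  \<open>c i\<close> times the full product, the same for all \<open>i\<close>; so these terms
  cancel when the \<open>c i\<close> sum to zero.\<close>

lemma wsum_eigen:
  assumes C: "C \<subseteq> {0..n}" and g: "\<And>i. i \<in> C \<Longrightarrow> g i = \<gamma> + c i * X i ^ r" and c: "sum c C = 0"
  shows "(\<Sum>i\<in>C. g i * omit_prod r C i) = \<gamma> * wsum r C (\<lambda>_. 1)"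
    and "lder n g (wsum r C (\<lambda>_. 1)) = of_nat r * (sum g C - \<gamma>) * wsum r C (\<lambda>_. 1)"
proof -
  have fin: "finite C" using C finite_subset by auto
  have "(\<Sum>i\<in>C. g i * omit_prod r C i) = (\<Sum>i\<in>C. \<gamma> * omit_prod r C i + c i * (\<Prod>j\<in>C. X j ^ r))"
    using g by (intro sum.cong refl) (simp add: algebra_simps flip: omit_prod_mult_X[OF fin])
  also have "\<dots> = \<gamma> * wsum r C (\<lambda>_. 1) + sum c C * (\<Prod>j\<in>C. X j ^ r)"
    by (simp add: wsum_def sum.distrib sum_distrib_left sum_distrib_right)
  finally show eq: "(\<Sum>i\<in>C. g i * omit_prod r C i) = \<gamma> * wsum r C (\<lambda>_. 1)" using c by simp
  show "lder n g (wsum r C (\<lambda>_. 1)) = of_nat r * (sum g C - \<gamma>) * wsum r C (\<lambda>_. 1)"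
    by (simp add: lder_wsum[OF C] eq algebra_simps)
qed

text \<open>The syzygies of the products \<open>omit_prod r C i\<close> are generated by those of pairs, because
  $x_i^r$ divides all of these products but the \<open>i\<close>-th one.\<close>

lemma wsum_dvd_lder:
  fixes g :: "nat \<Rightarrow> (nat, 'k::field_char_0) mpol"
  assumes C: "C \<subseteq> {0..n}" "C \<noteq> {}" and r: "r \<ge> 1" and g: "\<And>i. i \<in> C \<Longrightarrow> g i \<in> R n"
    and dvd: "wsum r C (\<lambda>_. 1) dvd lder n g (wsum r C (\<lambda>_. 1))"
  shows "\<exists>\<gamma> c. \<gamma> \<in> R n \<and> (\<forall>i\<in>C. c i \<in> R n \<and> g i = \<gamma> + c i * X i ^ r) \<and> sum c C = 0"
proof -
  let ?p = "wsum r C (\<lambda>_. 1) :: (nat, 'k) mpol"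
  let ?s = "\<Sum>i\<in>C. g i * omit_prod r C i"
  have fin: "finite C" using C finite_subset by auto
  have p: "?p \<noteq> 0" using fin C r by (intro wsum_nonzero) auto
  have in_R: "f \<in> polys_in C \<Longrightarrow> f \<in> R n" for f :: "(nat, 'k) mpol"
    unfolding R_eq_polys_in using polys_in_mono[OF C(1)] .
  have "lder n g ?p = sum g C * of_nat r * ?p - of_nat r * ?s"
    by (simp add: lder_wsum[OF C(1)] algebra_simps)
  with dvd have "?p dvd sum g C * of_nat r * ?p - of_nat r * ?s" by simp
  moreover have "?p dvd sum g C * of_nat r * ?p" by simp
  ultimately have "?p dvd sum g C * of_nat r * ?p - (sum g C * of_nat r * ?p - of_nat r * ?s)"
    by (rule dvd_diff[rotated])
  also have "\<dots> = cst (of_nat r) * ?s" by (simp add: cst_of_nat algebra_simps)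
  finally have "?p dvd cst (of_nat r) * ?s" .
  moreover have "cst (of_nat r) dvd (1 :: (nat, 'k) mpol)" using r by (auto simp: unit_iff_cst)
  ultimately have "?p dvd ?s" using dvd_mult_unit_cancel by blast
  then obtain \<gamma> where \<gamma>: "?s = ?p * \<gamma>" by (rule dvdE)
  have "?s \<in> R n"
    using g in_R[OF omit_prod_polys_in] unfolding R_eq_polys_in by (intro polys_in_sum polys_in_mult) auto
  then have \<gamma>_in: "\<gamma> \<in> R n" using \<gamma> polys_in_multD[of ?p \<gamma>] p by (auto simp: R_eq_polys_in)
  \<comment> \<open>The omitted products add up to \<open>wsum r C (\<lambda>_. 1)\<close>, so
    subtracting \<gamma> from each coefficient leaves a syzygy.\<close>
  have syz: "(\<Sum>i\<in>C. (g i - \<gamma>) * omit_prod r C i) = 0"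
  proof -
    have "(\<Sum>i\<in>C. (g i - \<gamma>) * omit_prod r C i) = ?s - \<gamma> * (\<Sum>i\<in>C. omit_prod r C i)"
      by (simp only: left_diff_distrib sum_subtractf sum_distrib_left)
    then show ?thesis using \<gamma> by (simp add: wsum_def mult.commute)
  qed
  have "X i ^ r dvd g i - \<gamma>" if i: "i \<in> C" for i
  proof -
    have "X i ^ r dvd (\<Sum>j\<in>C - {i}. (g j - \<gamma>) * omit_prod r C j)"
    proof (rule dvd_sum)
      fix j assume "j \<in> C - {i}"
      then show "X i ^ r dvd (g j - \<gamma>) * omit_prod r C j"
        unfolding omit_prod_def using fin i by (intro dvd_mult dvd_prodI) auto
    qed
    moreover have "(g i - \<gamma>) * omit_prod r C i + (\<Sum>j\<in>C - {i}. (g j - \<gamma>) * omit_prod r C j) = 0"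
      using syz fin i by (simp add: sum.remove)
    then have "omit_prod r C i * (g i - \<gamma>) = - (\<Sum>j\<in>C - {i}. (g j - \<gamma>) * omit_prod r C j)"
      by (simp add: eq_neg_iff_add_eq_0 mult.commute)
    ultimately have "X i ^ r dvd omit_prod r C i * (g i - \<gamma>)" by simp
    moreover have "no_common_factor (X i ^ r) (omit_prod r C i :: (nat, 'k) mpol)"
      unfolding omit_prod_def
    proof (intro no_common_factor_prod no_common_factor_power)
      fix j assume j: "j \<in> C - {i}"
      show "no_common_factor (X i ^ r) (X j :: (nat, 'k) mpol)"
        by (rule no_common_factor_polys_in[of _ "{i}" _ "{j}"]) (use j in auto)
    qed
    ultimately show ?thesis using no_common_factor_dvd_multD[of "X i ^ r"] by simp
  qed
  then have "\<forall>i\<in>C. \<exists>c. g i - \<gamma> = X i ^ r * c" by (auto simp: dvd_def)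
  then obtain c where c: "\<forall>i\<in>C. g i - \<gamma> = X i ^ r * c i" by metis
  have "c i \<in> R n" if i: "i \<in> C" for i
  proof -
    have "X i ^ r * c i \<in> R n"
      using c g[OF i] \<gamma>_in i unfolding R_eq_polys_in by (metis polys_in_diff)
    then show ?thesis using polys_in_multD[of "X i ^ r" "c i"] by (auto simp: R_eq_polys_in)
  qed
  moreover have g_eq: "g i = \<gamma> + c i * X i ^ r" if "i \<in> C" for i
    using c that by (metis add.commute diff_add_cancel mult.commute)
  \<comment> \<open>The syzygy becomes \<open>sum c C\<close> times the full product, which is
    non-zero.\<close>
  moreover have "sum c C = 0"
  proof -
    have "(\<Sum>i\<in>C. (g i - \<gamma>) * omit_prod r C i) = (\<Sum>i\<in>C. c i * (\<Prod>j\<in>C. X j ^ r))"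
      using c fin by (intro sum.cong refl) (simp add: mult_ac flip: omit_prod_mult_X)
    then have "sum c C * (\<Prod>j\<in>C. X j ^ r) = 0" using syz by (simp add: sum_distrib_right)
    moreover have "(\<Prod>j\<in>C. X j ^ r :: (nat, 'k) mpol) \<noteq> 0" using fin by simp
    ultimately show ?thesis by (metis mult_eq_0_iff)
  qed
  ultimately show ?thesis using \<gamma>_in by blast
qed

text \<open>Points of the projective line enter through chosen coordinates; that they differ
  pairwise is the non-vanishing of the 2 by 2 determinants.\<close>

locale pencil =
  fixes n r m :: nat and I :: "nat set" and a b :: "nat \<Rightarrow> 'k::field_char_0"
  assumes m: "m < n" and r: "r \<ge> 1" and fin_I: "finite I"
    and a: "\<And>i. i \<in> I \<Longrightarrow> a i \<noteq> 0" and b: "\<And>i. i \<in> I \<Longrightarrow> b i \<noteq> 0"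
    and distinct: "\<And>i j. i \<in> I \<Longrightarrow> j \<in> I \<Longrightarrow> i \<noteq> j \<Longrightarrow> a i * b j \<noteq> a j * b i"
begin

section \<open>The factors of the divisor and their coprimality\<close>

definition A :: "nat set" where "A = {0..m}"
definition B :: "nat set" where "B = {m+1..n}"

definition p :: "(nat, 'k) mpol" where "p = wsum r A (\<lambda>_. 1)"
definition q :: "(nat, 'k) mpol" where "q = wsum r B (\<lambda>_. 1)"
definition F1 :: "(nat, 'k) mpol" where "F1 = f1 n r m"
definition F2 :: "(nat, 'k) mpol" where "F2 = f2 n r m"
definition L :: "nat \<Rightarrow> (nat, 'k) mpol" where "L i = cst (a i) * F1 + cst (b i) * F2"
definition \<Lambda> :: "(nat, 'k) mpol" where "\<Lambda> = prod L I"
definition F :: "(nat, 'k) mpol" where "F = f12_red n r m * \<Lambda>"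

lemma AB: "A \<union> B = {0..n}" "A \<inter> B = {}" "A \<subseteq> {0..n}" "B \<subseteq> {0..n}" "A \<noteq> {}" "B \<noteq> {}"
  using m by (auto simp: A_def B_def)

lemma finite_AB [simp]: "finite A" "finite B"
  by (simp_all add: A_def B_def)

lemma sum_AB: "sum f {0..n} = sum f A + sum f B"
  using AB by (simp add: sum.union_disjoint flip: AB(1))

lemma f12_red_eq: "f12_red n r m = (\<Prod>i=0..n. X i) * p * q"
  by (simp add: f12_red_def p_def q_def wsum_def A_def B_def)

lemma omit_prod_A:
  assumes "i \<in> A" shows "omit_prod r {0..n} i = omit_prod r A i * (\<Prod>j\<in>B. X j ^ r)"
proof -
  have "{0..n} - {i} = (A - {i}) \<union> B" using assms AB by auto
  moreover have "(A - {i}) \<inter> B = {}" using AB by auto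
  ultimately show ?thesis unfolding omit_prod_def by (simp add: prod.union_disjoint)
qed

lemma omit_prod_B:
  assumes "i \<in> B" shows "omit_prod r {0..n} i = omit_prod r B i * (\<Prod>j\<in>A. X j ^ r)"
proof -
  have "{0..n} - {i} = (B - {i}) \<union> A" using assms AB by auto
  moreover have "(B - {i}) \<inter> A = {}" using AB by auto
  ultimately show ?thesis unfolding omit_prod_def by (simp add: prod.union_disjoint)
qed

lemma F1_eq: "F1 = q * (\<Prod>j\<in>A. X j ^ r)"
  unfolding F1_def f1_def q_def wsum_def sum_distrib_right
  by (rule sum.cong) (simp_all add: omit_prod_B B_def)

lemma F2_eq: "F2 = p * (\<Prod>j\<in>B. X j ^ r)"
  unfolding F2_def f2_def p_def wsum_def sum_distrib_right
  by (rule sum.cong) (simp_all add: omit_prod_A A_def)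

text \<open>In this form the general facts on \<open>wsum\<close>, in particular squarefreeness,
  apply to the members of the pencil.\<close>

lemma L_eq: "L i = wsum r {0..n} (\<lambda>j. if j \<le> m then b i else a i)"
proof -
  have "(\<Sum>j\<in>A. cst (if j \<le> m then b i else a i) * omit_prod r {0..n} j) = cst (b i) * F2"
    unfolding F2_def f2_def sum_distrib_left by (intro sum.cong) (auto simp: A_def)
  moreover have "(\<Sum>j\<in>B. cst (if j \<le> m then b i else a i) * omit_prod r {0..n} j) = cst (a i) * F1"
    unfolding F1_def f1_def sum_distrib_left by (intro sum.cong) (auto simp: B_def)
  ultimately show ?thesis by (simp add: wsum_def sum_AB L_def)
qed

lemma p_nonzero [simp]: "p \<noteq> 0" and q_nonzero [simp]: "q \<noteq> 0"
  unfolding p_def q_def by (rule wsum_nonzero; use AB r in simp)+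

lemma L_nonzero: "i \<in> I \<Longrightarrow> L i \<noteq> 0"
  unfolding L_eq using r a b by (intro wsum_nonzero) auto

lemma squarefree_L: "i \<in> I \<Longrightarrow> squarefree (L i)"
  unfolding L_eq using r a b by (intro squarefree_wsum) auto

lemma no_common_factor_p_q: "no_common_factor p q"
  unfolding p_def q_def
  using no_common_factor_polys_in[OF wsum_polys_in wsum_polys_in AB(2)] p_nonzero q_nonzero
  by (simp add: p_def q_def)

lemma no_common_factor_p_X: "no_common_factor p (X v)" and no_common_factor_q_X: "no_common_factor q (X v)"
  unfolding p_def q_def by (rule no_common_factor_wsum_X; use AB r in simp)+

text \<open>The source of the coprimality statements for the \<open>L i\<close>: eliminating from
  two members of the pencil shows that a common factor divides both \<open>F1\<close> and
  \<open>F2\<close>.\<close>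

lemma no_common_factor_F1_F2: "no_common_factor F1 F2"
proof -
  have "no_common_factor (\<Prod>j\<in>A. X j ^ r) (\<Prod>j\<in>B. X j ^ r :: (nat, 'k) mpol)"
    by (rule no_common_factor_polys_in[OF _ _ AB(2)]) (auto intro!: polys_in_prod polys_in_power)
  then show ?thesis
    unfolding F1_eq F2_eq no_common_factor_mult_iff
      no_common_factor_commute[of "_ * _"]
    using no_common_factor_p_q no_common_factor_p_X no_common_factor_q_X
    by (auto simp: no_common_factor_commute intro!: no_common_factor_prod no_common_factor_power)
qed

lemma no_common_factor_L_F2: "i \<in> I \<Longrightarrow> no_common_factor (L i) F2"
  unfolding no_common_factor_def
proof safe
  fix d assume i: "i \<in> I" and d: "irreducible d" "d dvd L i" "d dvd F2"
  then have "d dvd L i - cst (b i) * F2" by (intro dvd_diff dvd_mult)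
  then have "d dvd cst (a i) * F1" by (simp add: L_def)
  moreover have "cst (a i) dvd (1 :: (nat, 'k) mpol)" using a[OF i] by (auto simp: unit_iff_cst)
  ultimately have "d dvd F1" using dvd_mult_unit_cancel by blast
  with d show False using no_common_factor_F1_F2 by (auto simp: no_common_factor_def)
qed

lemma no_common_factor_L_F1: "i \<in> I \<Longrightarrow> no_common_factor (L i) F1"
  unfolding no_common_factor_def
proof safe
  fix d assume i: "i \<in> I" and d: "irreducible d" "d dvd L i" "d dvd F1"
  then have "d dvd L i - cst (a i) * F1" by (intro dvd_diff dvd_mult)
  then have "d dvd cst (b i) * F2" by (simp add: L_def)
  moreover have "cst (b i) dvd (1 :: (nat, 'k) mpol)" using b[OF i] by (auto simp: unit_iff_cst)
  ultimately have "d dvd F2" using dvd_mult_unit_cancel by blast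
  with d show False using no_common_factor_F1_F2 by (auto simp: no_common_factor_def)
qed

lemma no_common_factor_L_L:
  assumes ij: "i \<in> I" "j \<in> I" "i \<noteq> j"
  shows "no_common_factor (L i) (L j)"
  unfolding no_common_factor_def
proof safe
  fix d assume d: "irreducible d" "d dvd L i" "d dvd L j"
  then have "d dvd cst (b j) * L i - cst (b i) * L j" by (intro dvd_diff dvd_mult)
  also have "\<dots> = cst (a i * b j - a j * b i) * F1"
    by (simp add: L_def cst_diff cst_mult algebra_simps)
  finally have "d dvd cst (a i * b j - a j * b i) * F1" .
  moreover have "cst (a i * b j - a j * b i) dvd (1 :: (nat, 'k) mpol)"
    using distinct[OF ij] by (auto simp: unit_iff_cst)
  ultimately have "d dvd F1" using dvd_mult_unit_cancel by blast
  with d show False using no_common_factor_L_F1[OF ij(1)] by (auto simp: no_common_factor_def)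
qed

lemma squarefree_f12_red: "squarefree (f12_red n r m :: (nat, 'k) mpol)"
proof -
  have X: "squarefree (X i :: (nat, 'k) mpol)" for i
  proof (rule squarefreeI)
    fix x :: "(nat, 'k) mpol" assume "x ^ 2 dvd X i"
    then obtain s where "X i = x * (x * s)" by (auto simp: power2_eq_square dvd_def mult.assoc)
    with irreducible_X have "x dvd 1 \<or> x * s dvd 1" by (rule irreducibleD)
    then show "x dvd 1" using dvd_mult_left by blast
  qed
  have "squarefree (\<Prod>i=0..n. X i :: (nat, 'k) mpol)"
    by (intro squarefree_prod_no_common_factor X no_common_factor_X) (auto simp: X_dvd_X_iff)
  moreover have "squarefree p" "squarefree q"
    unfolding p_def q_def using AB r by (auto intro!: squarefree_wsum)
  moreover have "no_common_factor (\<Prod>i=0..n. X i) p" "no_common_factor (\<Prod>i=0..n. X i) q"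
    using no_common_factor_p_X no_common_factor_q_X
    by (auto simp: no_common_factor_commute[of "prod _ _"] intro!: no_common_factor_prod)
  ultimately show ?thesis unfolding f12_red_eq
    using no_common_factor_p_q
    by (intro squarefree_mult_no_common_factor)
      (auto simp: no_common_factor_mult_iff no_common_factor_commute[of "_ * _"] no_common_factor_commute[of q])
qed

lemma f12_red_dvd: "f12_red n r m dvd F1 * F2"
proof -
  have X: "(\<Prod>j\<in>C. X j) dvd (\<Prod>j\<in>C. X j ^ r :: (nat, 'k) mpol)" for C
    using r by (intro prod_dvd_prod dvd_power) auto
  have prod_AB: "(\<Prod>i=0..n. X i) = (\<Prod>i\<in>A. X i) * (\<Prod>i\<in>B. X i :: (nat, 'k) mpol)"
    using AB by (simp add: prod.union_disjoint flip: AB(1))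
  have "f12_red n r m = (q * (\<Prod>i\<in>A. X i)) * (p * (\<Prod>i\<in>B. X i))"
    by (simp add: f12_red_eq prod_AB mult_ac)
  also have "\<dots> dvd F1 * F2"
    unfolding F1_eq F2_eq by (intro mult_dvd_mono dvd_refl X)
  finally show ?thesis .
qed

lemma is_reduced_of_f12_red: "is_reduced_of (F1 * F2) (f12_red n r m)"
proof (rule is_reduced_ofI[OF squarefree_f12_red f12_red_dvd])
  fix d assume d: "irreducible d" "d dvd F1 * F2"
  have X: "d dvd (\<Prod>i=0..n. X i)" if "d dvd (\<Prod>j\<in>C. X j ^ r)" "C \<subseteq> {0..n}" for C
  proof -
    from irreducible_dvd_prodD[OF d(1) that(1)] obtain j where "j \<in> C" "d dvd X j ^ r" by blast
    moreover from this have "d dvd X j" using irreducible_dvd_powerD[OF d(1)] by blast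
    moreover have "X j dvd (\<Prod>i=0..n. X i :: (nat, 'k) mpol)"
      using that(2) \<open>j \<in> C\<close> by (intro dvd_prodI) auto
    ultimately show ?thesis by (meson dvd_trans)
  qed
  have "d dvd q \<or> d dvd (\<Prod>j\<in>A. X j ^ r) \<or> d dvd p \<or> d dvd (\<Prod>j\<in>B. X j ^ r)"
    using d irreducible_dvd_multD unfolding F1_eq F2_eq by blast
  then have "d dvd (\<Prod>i=0..n. X i) \<or> d dvd p \<or> d dvd q"
    using X[of A] X[of B] AB by blast
  then show "d dvd f12_red n r m" unfolding f12_red_eq by auto
qed

lemma no_common_factor_f12_red_L:
  assumes "i \<in> I" shows "no_common_factor (f12_red n r m) (L i)"
proof -
  have "no_common_factor (L i) (F1 * F2)"
    using no_common_factor_L_F1[OF assms] no_common_factor_L_F2[OF assms]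
    by (simp add: no_common_factor_mult_iff)
  then show ?thesis using no_common_factor_dvd f12_red_dvd no_common_factor_commute by blast
qed

lemma squarefree_F: "squarefree F"
  unfolding F_def \<Lambda>_def using fin_I
  by (intro squarefree_mult_no_common_factor squarefree_f12_red squarefree_prod_no_common_factor
      squarefree_L no_common_factor_L_L no_common_factor_prod no_common_factor_f12_red_L)

lemma F_nonzero [simp]: "F \<noteq> 0"
  using squarefree_F by auto

lemma \<Lambda>_nonzero [simp]: "\<Lambda> \<noteq> 0"
  using F_nonzero by (auto simp: F_def)

section \<open>The equation for annihilating the product\<close>

definition L_omit :: "nat \<Rightarrow> (nat, 'k) mpol" where "L_omit i = prod L (I - {i})"
text \<open>Formally \<open>F2 * \<Lambda>\<close> times the sum of the b_i / L_i. It arises because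
  \<beta> - \<alpha> = \<open>H * L i * L_omit i\<close> turns the defect of \<open>L i\<close> in
  \<open>lder_L\<close> into a multiple of \<open>L i\<close>.\<close>

definition M :: "(nat, 'k) mpol" where "M = F2 * (\<Sum>i\<in>I. cst (b i) * L_omit i)"

lemma L_mult_omit: "i \<in> I \<Longrightarrow> L i * L_omit i = \<Lambda>"
  unfolding \<Lambda>_def L_omit_def using fin_I by (simp add: prod.remove)

text \<open>Coefficients of the derivations that are logarithmic along the $x_i$, \<open>p\<close> and \<open>q\<close>.\<close>

definition log_coeffs ::
  "(nat \<Rightarrow> (nat, 'k) mpol) \<Rightarrow> (nat, 'k) mpol \<Rightarrow> (nat, 'k) mpol \<Rightarrow> (nat \<Rightarrow> (nat, 'k) mpol) \<Rightarrow> bool"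
  where "log_coeffs g \<alpha> \<beta> c \<longleftrightarrow>
     (\<forall>i\<in>A. g i = \<alpha> + c i * X i ^ r) \<and> (\<forall>i\<in>B. g i = \<beta> + c i * X i ^ r) \<and>
     sum c A = 0 \<and> sum c B = 0"

definition csum :: "(nat \<Rightarrow> (nat, 'k) mpol) \<Rightarrow> (nat, 'k) mpol" where
  "csum c = (\<Sum>i\<in>{0..n}. c i * X i ^ r)"

text \<open>\<open>N\<close>, \<open>e\<close> and \<open>Q\<close> are the coefficients of \<open>\<alpha>\<close>, \<open>csum c\<close> and \<open>H\<close> in the equation for
  annihilating \<open>F\<close>, see \<open>lder_F\<close>.\<close>

definition N :: 'k where
  "N = of_nat (n + 1) + of_nat r * (of_nat n - 1) + of_nat r * of_nat (card I) * of_nat n"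

definition e :: 'k where "e = of_nat (r + 1 + r * card I)"

text \<open>What the substitution \<beta> = \<alpha> + \<open>H * \<Lambda>\<close> contributes to
  the coefficient of \<open>H\<close>: \<beta> occurs in n - m of the \<open>g i\<close>, and is
  subtracted once in the eigenvalue of \<open>q\<close> and once for each
  \<open>L i\<close>.\<close>

definition \<kappa> :: 'k where
  "\<kappa> = of_nat (n - m) * (of_nat (r + 1) + of_nat r * of_nat (card I)) - of_nat r - of_nat r * of_nat (card I)"

definition Q :: "(nat, 'k) mpol" where "Q = cst \<kappa> * \<Lambda> + of_nat r * M"

text \<open>\<open>N\<close> is the degree of \<open>F\<close>, by Euler's formula. Writing n = k +
  1 removes the subtraction and exhibits it as a positive natural number.\<close>

lemma N_nonzero: "N \<noteq> 0"
proof -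
  obtain k where k: "n = Suc k" using m by (cases n) auto
  have "N = of_nat (n + 1 + r * k + r * card I * n)"
    unfolding N_def by (simp add: k algebra_simps)
  then show ?thesis by (simp only: of_nat_eq_0_iff)
qed

context
  fixes g \<alpha> \<beta> c
  assumes log: "log_coeffs g \<alpha> \<beta> c"
begin

lemma lder_p: "lder n g p = of_nat r * (sum g A - \<alpha>) * p"
  unfolding p_def using log AB by (intro wsum_eigen(2)[where c = c]) (auto simp: log_coeffs_def)

lemma lder_q: "lder n g q = of_nat r * (sum g B - \<beta>) * q"
  unfolding q_def using log AB by (intro wsum_eigen(2)[where c = c]) (auto simp: log_coeffs_def)

lemma lder_prod_X_power:
  assumes "C \<subseteq> {0..n}"
  shows "lder n g (\<Prod>j\<in>C. X j ^ r) = of_nat r * sum g C * (\<Prod>j\<in>C. X j ^ r)"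
proof -
  have "lder n g (\<Prod>j\<in>C. X j ^ r) = (\<Sum>j\<in>C. of_nat r * g j) * (\<Prod>j\<in>C. X j ^ r)"
    using assms by (intro lder_eigen_prod lder_eigen_power lder_X) auto
  then show ?thesis by (simp add: sum_distrib_left)
qed

lemma lder_F1: "lder n g F1 = of_nat r * (sum g {0..n} - \<beta>) * F1"
  unfolding F1_eq using lder_eigen_mult[OF lder_q lder_prod_X_power[OF AB(3)]]
  by (simp add: sum_AB algebra_simps)

lemma lder_F2: "lder n g F2 = of_nat r * (sum g {0..n} - \<alpha>) * F2"
  unfolding F2_eq using lder_eigen_mult[OF lder_p lder_prod_X_power[OF AB(4)]]
  by (simp add: sum_AB algebra_simps)

text \<open>The eigenvalues of \<open>F1\<close> and \<open>F2\<close> differ by r (\<beta> -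
  \<alpha>), so \<open>L i\<close> is an eigenvector up to a multiple of \<open>F2\<close>. That
  multiple is what forces \<open>L i\<close> to divide \<beta> - \<alpha>.\<close>

lemma lder_L: "lder n g (L i) = of_nat r * ((sum g {0..n} - \<beta>) * L i + cst (b i) * (\<beta> - \<alpha>) * F2)"
  by (simp add: L_def lder_add lder_cst_mult lder_F1 lder_F2 algebra_simps)

lemma sum_g: "sum g {0..n} = of_nat (m + 1) * \<alpha> + of_nat (n - m) * \<beta> + csum c"
proof -
  have "sum g A = of_nat (m + 1) * \<alpha> + (\<Sum>i\<in>A. c i * X i ^ r)"
  proof -
    have "sum g A = (\<Sum>i\<in>A. \<alpha> + c i * X i ^ r)" using log by (intro sum.cong) (auto simp: log_coeffs_def)
    then show ?thesis by (simp add: sum.distrib A_def)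
  qed
  moreover have "sum g B = of_nat (n - m) * \<beta> + (\<Sum>i\<in>B. c i * X i ^ r)"
  proof -
    have "sum g B = (\<Sum>i\<in>B. \<beta> + c i * X i ^ r)" using log by (intro sum.cong) (auto simp: log_coeffs_def)
    then show ?thesis by (simp add: sum.distrib B_def)
  qed
  ultimately show ?thesis by (simp add: sum_AB csum_def)
qed

context
  fixes H
  assumes H: "\<beta> = \<alpha> + H * \<Lambda>"
begin

lemma lder_L_eigen:
  assumes "i \<in> I"
  shows "lder n g (L i) = of_nat r * (sum g {0..n} - \<beta> + H * F2 * (cst (b i) * L_omit i)) * L i"
proof -
  have "\<beta> - \<alpha> = H * (L i * L_omit i)" using H L_mult_omit[OF assms] by simp
  then show ?thesis by (simp add: lder_L algebra_simps)
qed

lemma lder_\<Lambda>: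
  "lder n g \<Lambda> = of_nat r * (of_nat (card I) * (sum g {0..n} - \<beta>) + H * M) * \<Lambda>"
proof -
  have "lder n g \<Lambda> =
      (\<Sum>i\<in>I. of_nat r * (sum g {0..n} - \<beta> + H * F2 * (cst (b i) * L_omit i))) * \<Lambda>"
    unfolding \<Lambda>_def by (rule lder_eigen_prod) (rule lder_L_eigen)
  also have "(\<Sum>i\<in>I. of_nat r * (sum g {0..n} - \<beta> + H * F2 * (cst (b i) * L_omit i))) =
      of_nat r * (of_nat (card I) * (sum g {0..n} - \<beta>) + H * M)"
    by (simp only: M_def sum.distrib sum_constant mult.assoc flip: sum_distrib_left)
  finally show ?thesis .
qed

lemma lder_F: "lder n g F = (cst N * \<alpha> + cst e * csum c + H * Q) * F"
proof -
  let ?G = "sum g {0..n}" and ?k = "of_nat (card I) :: (nat, 'k) mpol"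
  have X: "lder n g (\<Prod>i=0..n. X i) = ?G * (\<Prod>i=0..n. X i)"
    by (intro lder_eigen_prod lder_X) auto
  have "lder n g F = (?G + of_nat r * (sum g A - \<alpha>) + of_nat r * (sum g B - \<beta>) +
      of_nat r * (?k * (?G - \<beta>) + H * M)) * F"
    unfolding F_def f12_red_eq by (intro lder_eigen_mult X lder_p lder_q lder_\<Lambda>)
  also have "?G + of_nat r * (sum g A - \<alpha>) + of_nat r * (sum g B - \<beta>) + of_nat r * (?k * (?G - \<beta>) + H * M)
      = (1 + of_nat r + of_nat r * ?k) * ?G - of_nat r * (\<alpha> + \<beta> + ?k * \<beta>) + H * (of_nat r * M)"
    by (simp add: sum_AB algebra_simps)
  also have "\<dots> = cst N * \<alpha> + cst e * csum c + H * Q"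
  proof -
    \<comment> \<open>The block sizes are m + 1 and n - m, while \<open>N\<close> is written in
      terms of \<open>n\<close>.\<close>
    have "of_nat n = of_nat m + (of_nat (n - m) :: (nat, 'k) mpol)" using m by (simp flip: of_nat_add)
    then show ?thesis
      by (simp add: H sum_g N_def e_def \<kappa>_def Q_def cst_add cst_diff cst_mult cst_of_nat algebra_simps)
  qed
  finally show ?thesis .
qed

end

end

text \<open>Weighting the \<open>g i\<close> with the omitted products of a block makes the
  \<open>c i\<close> cancel and leaves \<alpha> times \<open>p\<close> or \<beta> times
  \<open>q\<close>; the \<open>c i\<close> are then recovered by cancelling the powers of the
  variables.\<close>

lemma log_coeffs_unique:
  assumes "log_coeffs g \<alpha> \<beta> c" "log_coeffs g' \<alpha>' \<beta>' c'" "\<And>i. i \<le> n \<Longrightarrow> g i = g' i"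
  shows "\<alpha> = \<alpha>'" "\<beta> = \<beta>'" "\<And>i. i \<le> n \<Longrightarrow> c i = c' i"
proof -
  have sum_p: "(\<Sum>i\<in>A. g i * omit_prod r A i) = \<alpha> * p" if "log_coeffs g \<alpha> \<beta> c" for g \<alpha> \<beta> c
    unfolding p_def using that AB by (intro wsum_eigen(1)[where c = c]) (auto simp: log_coeffs_def)
  have sum_q: "(\<Sum>i\<in>B. g i * omit_prod r B i) = \<beta> * q" if "log_coeffs g \<alpha> \<beta> c" for g \<alpha> \<beta> c
    unfolding q_def using that AB by (intro wsum_eigen(1)[where c = c]) (auto simp: log_coeffs_def)
  have g_eq: "g i = g' i" if "i \<in> A \<or> i \<in> B" for i
    using that assms(3)[of i] by (auto simp: A_def B_def intro: order_trans[OF _ less_imp_le[OF m]])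
  have "(\<Sum>i\<in>A. g i * omit_prod r A i) = (\<Sum>i\<in>A. g' i * omit_prod r A i)"
    by (intro sum.cong refl) (simp add: g_eq)
  then have "\<alpha> * p = \<alpha>' * p" by (simp only: sum_p[OF assms(1)] sum_p[OF assms(2)])
  then show \<alpha>: "\<alpha> = \<alpha>'" using p_nonzero by (metis mult_right_cancel)
  have "(\<Sum>i\<in>B. g i * omit_prod r B i) = (\<Sum>i\<in>B. g' i * omit_prod r B i)"
    by (intro sum.cong refl) (simp add: g_eq)
  then have "\<beta> * q = \<beta>' * q" by (simp only: sum_q[OF assms(1)] sum_q[OF assms(2)])
  then show \<beta>: "\<beta> = \<beta>'" using q_nonzero by (metis mult_right_cancel)
  show "c i = c' i" if "i \<le> n" for i
  proof -
    have "i \<in> A \<or> i \<in> B" using that by (auto simp: A_def B_def)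
    then have "c i * X i ^ r = c' i * X i ^ r"
      using assms(1,2) assms(3)[OF that] \<alpha> \<beta> by (auto simp: log_coeffs_def)
    moreover have "(X i ^ r :: (nat, 'k) mpol) \<noteq> 0" by simp
    ultimately show ?thesis by (metis mult_right_cancel)
  qed
qed

section \<open>Parametrisation of the module\<close>

text \<open>The module is parametrised freely by \<open>z 1, \<dots>, z n\<close>: the value at \<open>m + 1\<close> is \<open>H\<close>, the
  others are the \<open>c i\<close> for \<open>i\<close> different from \<open>0\<close> and \<open>m + 1\<close>.\<close>

definition coeff_c :: "(nat \<Rightarrow> (nat, 'k) mpol) \<Rightarrow> nat \<Rightarrow> (nat, 'k) mpol" where
  "coeff_c z i = (if i = 0 then - sum z {1..m} else if i = m + 1 then - sum z {m+2..n} else z i)"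

text \<open>The solution for \<alpha> of the equation that the eigenvalue in \<open>lder_F\<close>
  is zero.\<close>

definition coeff_\<alpha> :: "(nat \<Rightarrow> (nat, 'k) mpol) \<Rightarrow> (nat, 'k) mpol" where
  "coeff_\<alpha> z = - cst (1 / N) * (cst e * csum (coeff_c z) + z (m + 1) * Q)"

definition coeff_g :: "(nat \<Rightarrow> (nat, 'k) mpol) \<Rightarrow> nat \<Rightarrow> (nat, 'k) mpol" where
  "coeff_g z i = coeff_\<alpha> z + (if i \<le> m then 0 else z (m + 1) * \<Lambda>) + coeff_c z i * X i ^ r"

lemma log_coeffs_coeff_g:
  "log_coeffs (coeff_g z) (coeff_\<alpha> z) (coeff_\<alpha> z + z (m + 1) * \<Lambda>) (coeff_c z)"
proof -
  have "sum (coeff_c z) A = coeff_c z 0 + sum (coeff_c z) {1..m}"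
    unfolding A_def by (simp add: sum.atLeast_Suc_atMost)
  also have "sum (coeff_c z) {1..m} = sum z {1..m}"
    by (intro sum.cong) (auto simp: coeff_c_def)
  finally have "sum (coeff_c z) A = 0" by (simp add: coeff_c_def)
  moreover have "sum (coeff_c z) B = coeff_c z (m + 1) + sum (coeff_c z) {m+2..n}"
    unfolding B_def using m by (simp add: sum.atLeast_Suc_atMost)
  moreover have "sum (coeff_c z) {m+2..n} = sum z {m+2..n}"
    by (intro sum.cong) (auto simp: coeff_c_def)
  ultimately show ?thesis
    by (auto simp: log_coeffs_def coeff_g_def coeff_c_def A_def B_def)
qed

lemma coeff_c_cong: "(\<And>j. j \<in> {1..n} \<Longrightarrow> z j = z' j) \<Longrightarrow> i \<le> n \<Longrightarrow> coeff_c z i = coeff_c z' i"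
  using m by (auto simp: coeff_c_def intro!: sum.cong)

lemma coeff_g_cong:
  assumes "\<And>j. j \<in> {1..n} \<Longrightarrow> z j = z' j" "i \<le> n"
  shows "coeff_g z i = coeff_g z' i"
proof -
  have "z (m + 1) = z' (m + 1)" using assms(1) m by simp
  moreover have "csum (coeff_c z) = csum (coeff_c z')"
    unfolding csum_def using coeff_c_cong[of z z'] assms(1) by (intro sum.cong) auto
  ultimately show ?thesis
    using coeff_c_cong[of z z' i] assms by (simp add: coeff_g_def coeff_\<alpha>_def)
qed

lemma coeff_c_add: "coeff_c (\<lambda>l. y l + z l) i = coeff_c y i + coeff_c z i"
  by (simp add: coeff_c_def sum.distrib)

lemma coeff_c_mult: "coeff_c (\<lambda>l. x * z l) i = x * coeff_c z i"
  by (simp add: coeff_c_def sum_distrib_left)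

lemma coeff_g_add: "coeff_g (\<lambda>l. y l + z l) i = coeff_g y i + coeff_g z i"
proof -
  have "csum (coeff_c (\<lambda>l. y l + z l)) = csum (coeff_c y) + csum (coeff_c z)"
    by (simp add: csum_def coeff_c_add distrib_right sum.distrib)
  then have "coeff_\<alpha> (\<lambda>l. y l + z l) = coeff_\<alpha> y + coeff_\<alpha> z"
    by (simp add: coeff_\<alpha>_def algebra_simps)
  then show ?thesis by (simp add: coeff_g_def coeff_c_add algebra_simps)
qed

lemma coeff_g_mult: "coeff_g (\<lambda>l. x * z l) i = x * coeff_g z i"
proof -
  have "csum (coeff_c (\<lambda>l. x * z l)) = x * csum (coeff_c z)"
    by (simp add: csum_def coeff_c_mult sum_distrib_left mult.assoc)
  then have "coeff_\<alpha> (\<lambda>l. x * z l) = x * coeff_\<alpha> z"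
    by (simp add: coeff_\<alpha>_def algebra_simps)
  then show ?thesis by (simp add: coeff_g_def coeff_c_mult algebra_simps)
qed

lemma coeff_g_sum: "coeff_g (\<lambda>l. \<Sum>j\<in>J. x j * y j l) i = (\<Sum>j\<in>J. x j * coeff_g (y j) i)"
proof -
  have "coeff_g (\<lambda>_. 0) i = 0" using coeff_g_mult[of 0 "\<lambda>_. 0" i] by simp
  then show ?thesis
    by (induction J rule: infinite_finite_induct) (simp_all add: coeff_g_add coeff_g_mult)
qed

definition unit_vec :: "nat \<Rightarrow> nat \<Rightarrow> (nat, 'k) mpol" where "unit_vec j l = (if l = j then 1 else 0)"

lemma coeff_g_unit_vec:
  assumes "i \<le> n"
  shows "coeff_g z i = (\<Sum>j\<in>{1..n}. z j * coeff_g (unit_vec j) i)"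
proof -
  have "(\<Sum>j\<in>{1..n}. z j * unit_vec j l) = z l" if "l \<in> {1..n}" for l
    using that by (simp add: unit_vec_def if_distrib cong: if_cong)
  then have "coeff_g z i = coeff_g (\<lambda>l. \<Sum>j\<in>{1..n}. z j * unit_vec j l) i"
    using assms by (intro coeff_g_cong) simp_all
  then show ?thesis by (simp only: coeff_g_sum)
qed

lemma F1_in_R: "F1 \<in> R n" and F2_in_R: "F2 \<in> R n"
  unfolding F1_def F2_def f1_def f2_def R_eq_polys_in
  by (intro polys_in_sum omit_prod_polys_in)+

lemma L_in_R: "L i \<in> R n"
  unfolding L_def R_eq_polys_in
  by (intro polys_in_add polys_in_mult polys_in_cst F1_in_R[unfolded R_eq_polys_in] F2_in_R[unfolded R_eq_polys_in])

lemma prod_L_in_R: "prod L J \<in> R n"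
  unfolding R_eq_polys_in by (intro polys_in_prod L_in_R[unfolded R_eq_polys_in])

lemma p_in_R: "p \<in> R n" and q_in_R: "q \<in> R n"
  unfolding p_def q_def R_eq_polys_in
  using polys_in_mono[OF AB(3) wsum_polys_in] polys_in_mono[OF AB(4) wsum_polys_in] by auto

lemma f12_red_in_R: "f12_red n r m \<in> (R n :: (nat, 'k) mpol set)"
  unfolding f12_red_eq R_eq_polys_in
  using p_in_R q_in_R by (intro polys_in_mult polys_in_prod) (auto simp: R_eq_polys_in)

lemma F_in_R: "F \<in> R n"
  unfolding F_def \<Lambda>_def
  using f12_red_in_R prod_L_in_R polys_in_mult by (auto simp: R_eq_polys_in)

lemma Q_in_R: "Q \<in> R n"
proof -
  have "M \<in> polys_in {0..n}"
    unfolding M_def L_omit_def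
    using F2_in_R prod_L_in_R unfolding R_eq_polys_in by (intro polys_in_mult polys_in_sum polys_in_cst)
  moreover have "\<Lambda> \<in> polys_in {0..n}" using prod_L_in_R[of I] by (simp add: \<Lambda>_def R_eq_polys_in)
  ultimately show ?thesis
    unfolding Q_def R_eq_polys_in
    by (intro polys_in_add polys_in_mult polys_in_cst) (simp_all flip: cst_of_nat)
qed

lemma coeff_g_in_R:
  assumes z: "\<And>j. z j \<in> R n" and i: "i \<le> n"
  shows "coeff_g z i \<in> R n"
proof -
  note z' = z[unfolded R_eq_polys_in]
  have c: "coeff_c z j \<in> polys_in {0..n}" for j
    unfolding coeff_c_def using z' by (auto intro!: polys_in_uminus polys_in_sum)
  have \<alpha>: "coeff_\<alpha> z \<in> polys_in {0..n}"
    unfolding coeff_\<alpha>_def csum_def using Q_in_R[unfolded R_eq_polys_in] z' c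
    by (intro polys_in_mult polys_in_add polys_in_uminus polys_in_sum polys_in_power polys_in_cst) auto
  have "\<Lambda> \<in> polys_in {0..n}" using prod_L_in_R[of I] by (simp add: \<Lambda>_def R_eq_polys_in)
  then have "(if i \<le> m then 0 else z (m + 1) * \<Lambda>) \<in> polys_in {0..n}" using z' by auto
  then show ?thesis
    unfolding coeff_g_def R_eq_polys_in using \<alpha> c i
    by (intro polys_in_add polys_in_mult polys_in_power) auto
qed

lemma cst_N_coeff_\<alpha>: "cst N * coeff_\<alpha> z = - (cst e * csum (coeff_c z) + z (m + 1) * Q)"
proof -
  have "cst N * coeff_\<alpha> z = - (cst (N * (1 / N)) * (cst e * csum (coeff_c z) + z (m + 1) * Q))"
    by (simp only: coeff_\<alpha>_def cst_mult mult_minus_left mult_minus_right mult.assoc)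
  then show ?thesis using N_nonzero by simp
qed

lemma lder_coeff_g_in_Der0:
  assumes "\<And>j. z j \<in> R n"
  shows "lder n (coeff_g z) \<in> Der0 n F"
proof -
  have "lder n (coeff_g z) F = 0"
    unfolding lder_F[OF log_coeffs_coeff_g refl] cst_N_coeff_\<alpha> by simp
  then show ?thesis using assms coeff_g_in_R by (auto simp: Der0_def intro!: lder_in_Der)
qed

lemma Der0_dvd:
  assumes \<delta>: "\<delta> \<in> Der0 n F" and s: "F = s * w" "s \<in> R n"
  shows "s dvd \<delta> s"
proof -
  have "w \<in> R n" using s F_in_R F_nonzero polys_in_multD[of s w] by (auto simp: R_eq_polys_in)
  then show ?thesis
    using \<delta> s F_nonzero squarefree_F squarefree_imp_no_common_factor[of s w]
    by (intro Der_dvd[of \<delta> n s w]) (auto simp: Der0_def)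
qed

lemma Der0_parametrised:
  assumes \<delta>: "\<delta> \<in> Der0 n F"
  shows "\<exists>z. (\<forall>j. z j \<in> R n) \<and> (\<forall>f\<in>R n. \<delta> f = lder n (coeff_g z) f)"
proof -
  have Der: "\<delta> \<in> Der n" using \<delta> by (simp add: Der0_def)
  have "\<exists>g. g \<in> R n \<and> \<delta> (X i) = g * X i" if i: "i \<le> n" for i
  proof -
    have "X i dvd (\<Prod>i=0..n. X i :: (nat, 'k) mpol)" using i by (intro dvd_prodI) auto
    then have "X i dvd F" unfolding F_def f12_red_eq by (metis dvd_mult2)
    then obtain w where "F = X i * w" by (rule dvdE)
    moreover have X_in: "X i \<in> (R n :: (nat, 'k) mpol set)" using i by (simp add: R_eq_polys_in)
    ultimately have "X i dvd \<delta> (X i)" by (rule Der0_dvd[OF \<delta>])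
    then obtain g where g: "\<delta> (X i) = X i * g" by (rule dvdE)
    have "\<delta> (X i) \<in> R n" using Der X_in by (auto simp: Der_def)
    then have "g \<in> R n" using g polys_in_multD[of "X i" g] by (auto simp: R_eq_polys_in)
    with g show ?thesis by (auto simp: mult.commute)
  qed
  then obtain g where g: "\<And>i. i \<le> n \<Longrightarrow> g i \<in> R n \<and> \<delta> (X i) = g i * X i" by metis
  have eq: "\<delta> f = lder n g f" if "f \<in> R n" for f
  proof (rule Der_eqI[OF Der _ _ that])
    show "lder n g \<in> Der n" by (rule lder_in_Der) (simp add: g)
    show "\<delta> (X i) = lder n g (X i)" if "i \<le> n" for i using that by (simp add: g lder_X)
  qed
  have dvd: "s dvd lder n g s" if "s dvd F" "s \<in> R n" for s
  proof -
    from that(1) obtain w where "F = s * w" by (rule dvdE)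
    from Der0_dvd[OF \<delta> this that(2)] show ?thesis by (simp only: eq[OF that(2)])
  qed
  have "p dvd F" "q dvd F" unfolding F_def f12_red_eq by (simp_all add: mult.assoc mult.left_commute[of _ q])
  then have "p dvd lder n g p" "q dvd lder n g q" using dvd p_in_R q_in_R by blast+
  moreover have "g i \<in> R n" if "i \<in> A" for i using that g m by (simp add: A_def)
  moreover have "g i \<in> R n" if "i \<in> B" for i using that g by (simp add: B_def)
  ultimately obtain \<alpha> c \<beta> c' where
    \<alpha>: "\<alpha> \<in> R n" "\<forall>i\<in>A. c i \<in> R n \<and> g i = \<alpha> + c i * X i ^ r" "sum c A = 0" and
    \<beta>: "\<beta> \<in> R n" "\<forall>i\<in>B. c' i \<in> R n \<and> g i = \<beta> + c' i * X i ^ r" "sum c' B = 0"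
    using wsum_dvd_lder[OF AB(3,5) r, of g] wsum_dvd_lder[OF AB(4,6) r, of g]
    unfolding p_def q_def by metis
  define d where "d = (\<lambda>i. if i \<in> A then c i else c' i)"
  have not_A: "i \<notin> A" if "i \<in> B" for i using that AB(2) by auto
  have "sum d B = sum c' B" using not_A by (intro sum.cong) (auto simp: d_def)
  then have log: "log_coeffs g \<alpha> \<beta> d"
    using \<alpha> \<beta> not_A by (simp add: log_coeffs_def d_def)
  have d_in: "d i \<in> R n" if "i \<le> n" for i
    using that \<alpha>(2) \<beta>(2) by (auto simp: d_def A_def B_def)
  have "L i dvd \<beta> - \<alpha>" if i: "i \<in> I" for i
  proof -
    have "L i dvd \<Lambda>" unfolding \<Lambda>_def using i fin_I by (rule dvd_prodI[rotated])
    then have "L i dvd lder n g (L i)" using L_in_R by (intro dvd) (auto simp: F_def)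
    \<comment> \<open>Modulo \<open>L i\<close> only the term with \<open>F2\<close> remains, and
      \<open>L i\<close> is coprime to \<open>F2\<close>.\<close>
    moreover have "lder n g (L i) =
        (of_nat r * (sum g {0..n} - \<beta>)) * L i + cst (of_nat r * b i) * (F2 * (\<beta> - \<alpha>))"
      by (simp add: lder_L[OF log] cst_mult cst_of_nat algebra_simps)
    ultimately have "L i dvd cst (of_nat r * b i) * (F2 * (\<beta> - \<alpha>))"
      using dvd_add_right_iff[OF dvd_triv_right] by metis
    moreover have "cst (of_nat r * b i) dvd (1 :: (nat, 'k) mpol)" using r b[OF i] by (auto simp: unit_iff_cst)
    ultimately have "L i dvd F2 * (\<beta> - \<alpha>)" using dvd_mult_unit_cancel by blast
    then show ?thesis
      using no_common_factor_L_F2[OF i] L_nonzero[OF i] no_common_factor_dvd_multD by blast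
  qed
  then have "\<Lambda> dvd \<beta> - \<alpha>"
    unfolding \<Lambda>_def using fin_I L_nonzero no_common_factor_L_L
    by (intro prod_dvd_of_no_common_factor) auto
  then obtain H where "\<beta> - \<alpha> = \<Lambda> * H" by (rule dvdE)
  then have H: "\<beta> = \<alpha> + H * \<Lambda>" by (simp add: algebra_simps)
  have "\<Lambda> * H \<in> R n"
    using \<alpha>(1) \<beta>(1) unfolding R_eq_polys_in \<open>\<beta> - \<alpha> = \<Lambda> * H\<close>[symmetric] by (rule polys_in_diff[rotated])
  then have H_in: "H \<in> R n" using polys_in_multD[of \<Lambda> H] by (simp add: R_eq_polys_in)
  have "lder n g F = 0" using \<delta> eq[OF F_in_R] by (simp add: Der0_def)
  then have N: "cst N * \<alpha> + cst e * csum d + H * Q = 0"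
    using lder_F[OF log H] F_nonzero by (metis mult_eq_0_iff)
  \<comment> \<open>The slot \<open>m + 1\<close> is free to hold \<open>H\<close>, because
    \<open>d (m + 1)\<close> is determined by the rest of its block, just as \<open>d 0\<close>
    is.\<close>
  define z where "z = (\<lambda>i. if i = m + 1 then H else if i \<in> {1..n} then d i else 0)"
  have z_in: "z j \<in> R n" for j using H_in d_in by (simp add: z_def R_eq_polys_in)
  have c_eq: "coeff_c z i = d i" if i: "i \<le> n" for i
  proof -
    have "sum z {1..m} = sum d {1..m}"
      by (intro sum.cong refl) (use m in \<open>auto simp: z_def\<close>)
    moreover have "sum z {m+2..n} = sum d {m+2..n}"
      by (intro sum.cong refl) (auto simp: z_def)
    moreover have "d 0 + sum d {1..m} = 0" "d (m + 1) + sum d {m+2..n} = 0"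
      using log m by (simp_all add: log_coeffs_def A_def B_def sum.atLeast_Suc_atMost)
    then have "- sum d {1..m} = d 0" "- sum d {m+2..n} = d (m + 1)"
      by (metis add.commute minus_unique)+
    ultimately show ?thesis using i by (auto simp: coeff_c_def z_def)
  qed
  have "csum (coeff_c z) = csum d" unfolding csum_def using c_eq by (intro sum.cong) auto
  moreover have "cst N * \<alpha> = - (cst e * csum d + H * Q)"
    using N by (simp only: eq_neg_iff_add_eq_0 add.assoc)
  moreover have "z (m + 1) = H" by (simp add: z_def)
  ultimately have "cst N * coeff_\<alpha> z = cst N * \<alpha>"
    by (simp only: cst_N_coeff_\<alpha>)
  then have "coeff_\<alpha> z = \<alpha>" using N_nonzero by simp
  then have "coeff_g z i = g i" if "i \<le> n" for i
    using that c_eq[OF that] log H by (auto simp: coeff_g_def log_coeffs_def z_def A_def B_def)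
  then have "lder n (coeff_g z) f = lder n g f" for f
    unfolding lder_def by (intro sum.cong) auto
  with z_in eq show ?thesis by metis
qed

section \<open>Degrees and the basis\<close>

lemma homogeneous_F1: "homogeneous (r * n) F1" and homogeneous_F2: "homogeneous (r * n) F2"
  unfolding F1_def F2_def f1_def f2_def
  using homogeneous_omit_prod[of "{0..n}" _ r, where 'a = 'k] m by (auto intro!: homogeneous_sum)

lemma homogeneous_L: "homogeneous (r * n) (L i)"
  unfolding L_def by (intro homogeneous_add homogeneous_cst_mult homogeneous_F1 homogeneous_F2)

lemma homogeneous_prod_L: "homogeneous (r * n * card J) (prod L J)"
  using homogeneous_prod[of J "\<lambda>_. r * n" L] homogeneous_L by (simp add: mult.commute)

lemma homogeneous_M: "homogeneous (r * n * card I) M"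
  unfolding M_def sum_distrib_left
proof (rule homogeneous_sum)
  fix i assume i: "i \<in> I"
  have "r * n + r * n * card (I - {i}) = r * n * card I"
    by (simp add: card.remove[OF fin_I i])
  moreover have "homogeneous (r * n + r * n * card (I - {i})) (F2 * (cst (b i) * L_omit i))"
    unfolding L_omit_def by (intro homogeneous_mult homogeneous_F2 homogeneous_cst_mult homogeneous_prod_L)
  ultimately show "homogeneous (r * n * card I) (F2 * (cst (b i) * L_omit i))" by simp
qed

lemma homogeneous_Q: "homogeneous (r * n * card I) Q"
  unfolding Q_def \<Lambda>_def
  using homogeneous_cst_mult[OF homogeneous_M, of "of_nat r"]
  by (intro homogeneous_add homogeneous_cst_mult homogeneous_prod_L) (simp add: cst_of_nat)

lemma homogeneous_F: "\<exists>d. homogeneous d F"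
proof -
  have "homogeneous (\<Sum>i\<in>{0..n}. 1) (\<Prod>i=0..n. X i :: (nat, 'k) mpol)"
    by (intro homogeneous_prod homogeneous_X)
  then have "homogeneous ((\<Sum>i\<in>{0..n}. 1) + r * (card A - 1) + r * (card B - 1) + r * n * card I) F"
    unfolding F_def f12_red_eq \<Lambda>_def p_def q_def
    by (intro homogeneous_mult homogeneous_wsum homogeneous_prod_L) auto
  then show ?thesis by blast
qed

text \<open>In the direction of \<open>H\<close> all \<open>c i\<close> vanish, leaving multiples of
  \<open>Q\<close> and \<Lambda>, which have the same degree. In any other direction
  \<open>H\<close> vanishes and the \<open>c i\<close> are constants, so only the powers x_i^r
  contribute.\<close>

lemma homogeneous_coeff_g_unit_vec:
  assumes j: "j \<in> {1..n}"
  shows "homogeneous (if j = m + 1 then r * n * card I else r) (coeff_g (unit_vec j) i)"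
proof (cases "j = m + 1")
  case True
  \<comment> \<open>The sums in \<open>coeff_c\<close> run over \<open>{1..m}\<close> and
    \<open>{m+2..n}\<close>, both of which skip m + 1.\<close>
  have c: "coeff_c (unit_vec j) l = 0" for l
    unfolding coeff_c_def unit_vec_def True by (auto intro!: sum.neutral)
  have "homogeneous (r * n * card I) (coeff_\<alpha> (unit_vec j))"
    unfolding coeff_\<alpha>_def csum_def c using homogeneous_cst_mult[OF homogeneous_Q, of "1 / N"]
    by (simp add: unit_vec_def True homogeneous_uminus)
  then have "homogeneous (r * n * card I) (coeff_g (unit_vec j) i)"
    unfolding coeff_g_def c using homogeneous_prod_L[of I]
    by (auto simp: unit_vec_def True \<Lambda>_def intro: homogeneous_add)
  then show ?thesis using True by simp
next
  case False
  have H: "unit_vec j (m + 1) = 0" using False by (simp add: unit_vec_def)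
  have u: "homogeneous 0 (unit_vec j l)" for l by (simp add: unit_vec_def)
  have "homogeneous 0 (coeff_c (unit_vec j) l)" for l
    unfolding coeff_c_def using u by (auto intro!: homogeneous_uminus homogeneous_sum)
  moreover have "homogeneous (r * 1) (X l ^ r :: (nat, 'k) mpol)" for l
    by (intro homogeneous_power homogeneous_X)
  ultimately have c: "homogeneous r (coeff_c (unit_vec j) l * X l ^ r)" for l
    using homogeneous_mult[of 0 "coeff_c (unit_vec j) l" r "X l ^ r"] by simp
  have "homogeneous r (coeff_\<alpha> (unit_vec j))"
    unfolding coeff_\<alpha>_def csum_def H mult_zero_left add_0_right cst_uminus[symmetric]
    by (intro homogeneous_cst_mult homogeneous_sum c)
  then have "homogeneous r (coeff_g (unit_vec j) i)"
    unfolding coeff_g_def H using c by (auto intro: homogeneous_add)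
  then show ?thesis using False by simp
qed

lemma lder_coeff_g_sum:
  "lder n (coeff_g z) f = (\<Sum>j\<in>{1..n}. z j * lder n (coeff_g (unit_vec j)) f)"
proof -
  have "lder n (coeff_g z) f = (\<Sum>i\<in>{0..n}. (\<Sum>j\<in>{1..n}. z j * coeff_g (unit_vec j) i) * xder i f)"
    unfolding lder_def using coeff_g_unit_vec by (intro sum.cong) auto
  also have "\<dots> = (\<Sum>j\<in>{1..n}. \<Sum>i\<in>{0..n}. z j * coeff_g (unit_vec j) i * xder i f)"
    unfolding sum_distrib_right by (rule sum.swap)
  finally show ?thesis by (simp add: lder_def sum_distrib_left mult.assoc)
qed

lemma lder_coeff_g_inject:
  assumes eq: "\<And>f. f \<in> R n \<Longrightarrow> lder n (coeff_g z) f = lder n (coeff_g z') f" and j: "j \<in> {1..n}"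
  shows "z j = z' j"
proof -
  have g: "coeff_g z i = coeff_g z' i" if "i \<le> n" for i
  proof -
    have "coeff_g z i * X i = coeff_g z' i * X i"
      using eq[of "X i"] that by (simp add: lder_X R_eq_polys_in)
    then show ?thesis using X_nonzero by (metis mult_right_cancel)
  qed
  note unique = log_coeffs_unique[OF log_coeffs_coeff_g log_coeffs_coeff_g g]
  show ?thesis
  proof (cases "j = m + 1")
    case True
    have "z (m + 1) * \<Lambda> = z' (m + 1) * \<Lambda>" using unique(1,2) by simp
    then show ?thesis using True \<Lambda>_nonzero by (metis mult_right_cancel)
  next
    case False
    then show ?thesis using unique(3)[of j] j by (simp add: coeff_c_def)
  qed
qed

text \<open>The enumeration \<pi> is arbitrary because the two lists of exponents place the one
  belonging to \<open>H\<close> at opposite ends.\<close>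

lemma is_basis_Der0:
  assumes \<pi>: "bij_betw \<pi> {..<n} {1..n}"
  shows "is_basis n (Der0 n F) n (\<lambda>j. lder n (coeff_g (unit_vec (\<pi> j))))"
proof -
  define \<sigma> where "\<sigma> = the_inv_into {..<n} \<pi>"
  have inj: "inj_on \<pi> {..<n}" and img: "\<pi> ` {..<n} = {1..n}" using \<pi> by (auto simp: bij_betw_def)
  have \<sigma>\<pi>: "\<sigma> (\<pi> j) = j" if "j < n" for j using that inj by (simp add: \<sigma>_def the_inv_into_f_f)
  have reindex: "(\<Sum>j<n. c j * lder n (coeff_g (unit_vec (\<pi> j))) f) = lder n (coeff_g (\<lambda>l. c (\<sigma> l))) f"
    for c f
  proof -
    have "(\<Sum>j<n. c j * lder n (coeff_g (unit_vec (\<pi> j))) f) =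
        (\<Sum>j<n. c (\<sigma> (\<pi> j)) * lder n (coeff_g (unit_vec (\<pi> j))) f)"
      using \<sigma>\<pi> by (intro sum.cong) auto
    also have "\<dots> = (\<Sum>l\<in>{1..n}. c (\<sigma> l) * lder n (coeff_g (unit_vec l)) f)"
      by (rule sum.reindex_bij_betw[OF \<pi>])
    finally show ?thesis by (simp only: lder_coeff_g_sum[of "\<lambda>l. c (\<sigma> l)"])
  qed
  have in_Der0: "lder n (coeff_g (unit_vec l)) \<in> Der0 n F" for l
    by (intro lder_coeff_g_in_Der0) (auto simp: unit_vec_def R_eq_polys_in)
  have unique: "\<exists>!c. c \<in> {..<n} \<rightarrow>\<^sub>E R n \<and>
      (\<forall>f\<in>R n. \<delta> f = (\<Sum>j<n. c j * lder n (coeff_g (unit_vec (\<pi> j))) f))" if \<delta>: "\<delta> \<in> Der0 n F" for \<delta>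
  proof -
    obtain z where z: "\<forall>j. z j \<in> R n" "\<forall>f\<in>R n. \<delta> f = lder n (coeff_g z) f"
      using Der0_parametrised[OF \<delta>] by blast
    define c where "c = (\<lambda>j\<in>{..<n}. z (\<pi> j))"
    have c_\<sigma>: "c (\<sigma> l) = z l" if "l \<in> {1..n}" for l
    proof -
      from that have "l \<in> \<pi> ` {..<n}" by (simp only: img)
      then obtain j where "j < n" "l = \<pi> j" by auto
      then show ?thesis using \<sigma>\<pi> by (simp add: c_def)
    qed
    have "lder n (coeff_g (\<lambda>l. c (\<sigma> l))) f = lder n (coeff_g z) f" for f
      unfolding lder_def using coeff_g_cong[of "\<lambda>l. c (\<sigma> l)" z] c_\<sigma> by (intro sum.cong) auto
    then have c: "\<forall>f\<in>R n. \<delta> f = (\<Sum>j<n. c j * lder n (coeff_g (unit_vec (\<pi> j))) f)"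
      using z(2) by (simp only: reindex)
    show ?thesis
    proof (rule ex1I[of _ c])
      show "c \<in> {..<n} \<rightarrow>\<^sub>E R n \<and>
          (\<forall>f\<in>R n. \<delta> f = (\<Sum>j<n. c j * lder n (coeff_g (unit_vec (\<pi> j))) f))"
        using z(1) c by (auto simp: c_def)
    next
      fix c' assume c': "c' \<in> {..<n} \<rightarrow>\<^sub>E R n \<and>
          (\<forall>f\<in>R n. \<delta> f = (\<Sum>j<n. c' j * lder n (coeff_g (unit_vec (\<pi> j))) f))"
      have "c' (\<sigma> l) = c (\<sigma> l)" if "l \<in> {1..n}" for l
        by (rule lder_coeff_g_inject[OF _ that]) (use c c' in \<open>simp flip: reindex\<close>)
      then have "c' (\<sigma> (\<pi> j)) = c (\<sigma> (\<pi> j))" if "j < n" for j using that img by blast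
      then have "c' j = c j" if "j < n" for j using that \<sigma>\<pi> by simp
      \<comment> \<open>Outside \<open>{..<n}\<close> both families take the default value of
        extensional functions.\<close>
      then show "c' = c" using c' by (intro ext) (auto simp: c_def PiE_def extensional_def)
    qed
  qed
  show ?thesis unfolding is_basis_def by (intro conjI allI impI ballI in_Der0 unique)
qed

text \<open>Any reduced polynomial is a non-zero constant times \<open>f12_red\<close>, and such a
  constant changes none of the conditions for freeness. The exceptional exponent stands where \<pi>
  takes the value m + 1.\<close>

theorem free_with_exponents_reduced:
  assumes \<pi>: "bij_betw \<pi> {..<n} {1..n}" and len: "length es = n"
    and es: "\<And>j. j < n \<Longrightarrow> es ! j = (if \<pi> j = m + 1 then r * n * card I + 1 else r + 1)"
    and g: "is_reduced_of (f1 n r m * f2 n r m) g"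
  shows "free_with_exponents n (g * (\<Prod>i\<in>I. cst (a i) * f1 n r m + cst (b i) * f2 n r m)) es"
proof -
  obtain s where s: "s \<noteq> 0" "g = cst s * f12_red n r m"
    using is_reduced_of_unique[OF is_reduced_of_f12_red[unfolded F1_def F2_def] g] by blast
  have eq: "g * (\<Prod>i\<in>I. cst (a i) * f1 n r m + cst (b i) * f2 n r m) = cst s * F"
    by (simp add: s(2) F_def \<Lambda>_def L_def F1_def F2_def mult.assoc)
  have "homogeneous_der n (es ! j) (lder n (coeff_g (unit_vec (\<pi> j))))" if j: "j < n" for j
    unfolding homogeneous_der_def
  proof
    fix i assume i: "i \<in> {0..n}"
    have "\<pi> j \<in> {1..n}" using \<pi> j by (auto simp: bij_betw_def)
    from homogeneous_mult[OF homogeneous_coeff_g_unit_vec[OF this, of i] homogeneous_X[of i]] es[OF j] i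
    show "homogeneous (es ! j) (lder n (coeff_g (unit_vec (\<pi> j))) (X i))"
      by (simp add: lder_X split: if_splits)
  qed
  moreover have "cst s * F \<in> R n" using F_in_R by (auto simp: R_eq_polys_in)
  moreover have "\<exists>d. homogeneous d (cst s * F)" using homogeneous_F homogeneous_cst_mult by blast
  moreover have "squarefree (cst s * F)" using squarefree_F s(1) by (rule squarefree_cst_mult)
  ultimately show ?thesis
    unfolding free_with_exponents_def eq Der0_cst_mult[OF F_in_R s(1)]
    using is_basis_Der0[OF \<pi>] len by blast
qed

end

section \<open>The open set of parameters\<close>

text \<open>Unlike in \<open>multihomogeneous\<close>, the degrees are visible, so that they can be
  added in products and compared in differences.\<close>

definition multidegree :: "nat set \<Rightarrow> (nat \<Rightarrow> nat) \<Rightarrow> (nat + nat, 'k::zero) mpol \<Rightarrow> bool" where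
  "multidegree I d f \<longleftrightarrow> (\<forall>t\<in>Poly_Mapping.keys f. Poly_Mapping.keys t \<subseteq> Inl ` I \<union> Inr ` I \<and>
     (\<forall>i\<in>I. Poly_Mapping.lookup t (Inl i) + Poly_Mapping.lookup t (Inr i) = d i))"

lemma multihomogeneousI: "multidegree I d f \<Longrightarrow> multihomogeneous I f"
  unfolding multidegree_def multihomogeneous_def by blast

lemma multidegree_1: "multidegree I (\<lambda>_. 0) (1 :: (nat + nat, 'k::zero_neq_one) mpol)"
  by (simp add: multidegree_def)

lemma multidegree_X:
  assumes "i \<in> I"
  shows "multidegree I (\<lambda>j. if j = i then 1 else 0) (X (Inl i) :: (nat + nat, 'k::zero_neq_one) mpol)"
    and "multidegree I (\<lambda>j. if j = i then 1 else 0) (X (Inr i) :: (nat + nat, 'k::zero_neq_one) mpol)"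
  using assms by (auto simp: multidegree_def X_def lookup_single when_def)

lemma multidegree_mult:
  fixes f g :: "(nat + nat, 'k::semiring_0) mpol"
  assumes "multidegree I d f" "multidegree I d' g"
  shows "multidegree I (\<lambda>i. d i + d' i) (f * g)"
  unfolding multidegree_def
proof
  fix t assume "t \<in> Poly_Mapping.keys (f * g)"
  then obtain u v where uv: "t = u + v" "u \<in> Poly_Mapping.keys f" "v \<in> Poly_Mapping.keys g"
    using keys_mult[of f g] by auto
  then have *:
    "Poly_Mapping.keys u \<subseteq> Inl ` I \<union> Inr ` I" "Poly_Mapping.keys v \<subseteq> Inl ` I \<union> Inr ` I"
    "\<forall>i\<in>I. Poly_Mapping.lookup u (Inl i) + Poly_Mapping.lookup u (Inr i) = d i"
    "\<forall>i\<in>I. Poly_Mapping.lookup v (Inl i) + Poly_Mapping.lookup v (Inr i) = d' i"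
    using assms unfolding multidegree_def by blast+
  show "Poly_Mapping.keys t \<subseteq> Inl ` I \<union> Inr ` I \<and>
      (\<forall>i\<in>I. Poly_Mapping.lookup t (Inl i) + Poly_Mapping.lookup t (Inr i) = d i + d' i)"
  proof (intro conjI ballI)
    fix i assume "i \<in> I"
    then have "Poly_Mapping.lookup u (Inl i) + Poly_Mapping.lookup u (Inr i) = d i"
      "Poly_Mapping.lookup v (Inl i) + Poly_Mapping.lookup v (Inr i) = d' i"
      using *(3,4) by blast+
    then show "Poly_Mapping.lookup t (Inl i) + Poly_Mapping.lookup t (Inr i) = d i + d' i"
      by (simp add: uv(1) lookup_add)
  qed (use keys_add[of u v] *(1,2) uv(1) in auto)
qed

lemma multidegree_diff:
  fixes f g :: "(nat + nat, 'k::ab_group_add) mpol"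
  assumes "multidegree I d f" "multidegree I d g"
  shows "multidegree I d (f - g)"
  unfolding multidegree_def
proof
  fix t assume "t \<in> Poly_Mapping.keys (f - g)"
  then have "t \<in> Poly_Mapping.keys f \<or> t \<in> Poly_Mapping.keys g"
    by (auto simp: in_keys_iff lookup_minus)
  with assms show "Poly_Mapping.keys t \<subseteq> Inl ` I \<union> Inr ` I \<and>
      (\<forall>i\<in>I. Poly_Mapping.lookup t (Inl i) + Poly_Mapping.lookup t (Inr i) = d i)"
    unfolding multidegree_def by blast
qed

lemma multidegree_prod:
  fixes f :: "'a \<Rightarrow> (nat + nat, 'k::comm_semiring_1) mpol"
  shows "(\<And>x. x \<in> A \<Longrightarrow> \<exists>d. multidegree I d (f x)) \<Longrightarrow> \<exists>d. multidegree I d (prod f A)"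
proof (induction A rule: infinite_finite_induct)
  case (insert x A)
  then obtain d d' where "multidegree I d (f x)" "multidegree I d' (prod f A)" by blast
  then have "multidegree I (\<lambda>i. d i + d' i) (prod f (insert x A))"
    using insert.hyps by (simp add: multidegree_mult)
  then show ?case by blast
qed (use multidegree_1 in auto)

lemma eval_diff:
  fixes p q :: "('v, 'k::comm_ring_1) mpol"
  shows "eval.subst x (p - q) = eval.subst x p - eval.subst x q"
  using eval.subst_add[of x "p - q" q] by simp

text \<open>Collecting all coordinates and all 2 by 2 determinants in one product lets a single
  multihomogeneous equation describe the tuples to be excluded.\<close>

definition genericity_form :: "nat set \<Rightarrow> (nat + nat, 'k::comm_ring_1) mpol" where
  "genericity_form I = (\<Prod>i\<in>I. X (Inl i) * X (Inr i)) *
     (\<Prod>(i, j)\<in>{(i, j)\<in>I \<times> I. i \<noteq> j}. X (Inl i) * X (Inr j) - X (Inl j) * X (Inr i))"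

lemma multihomogeneous_genericity_form:
  "multihomogeneous I (genericity_form I :: (nat + nat, 'k::comm_ring_1) mpol)"
proof -
  have 1: "\<exists>d. multidegree I d (X (Inl i) * X (Inr i) :: (nat + nat, 'k) mpol)" if "i \<in> I" for i
    using multidegree_mult[OF multidegree_X(1)[OF that] multidegree_X(2)[OF that]] by blast
  have 2: "\<exists>d. multidegree I d (X (Inl i) * X (Inr j) - X (Inl j) * X (Inr i) :: (nat + nat, 'k) mpol)"
    if "i \<in> I" "j \<in> I" for i j
  proof -
    let ?d = "\<lambda>l. (if l = i then 1 else 0 :: nat) + (if l = j then 1 else 0)"
    have "multidegree I ?d (X (Inl i) * X (Inr j) :: (nat + nat, 'k) mpol)"
      using multidegree_mult[OF multidegree_X(1) multidegree_X(2)] that by blast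
    \<comment> \<open>In this order of the factors the degree is literally \<open>?d\<close> again;
      commuting them gives the second term of the determinant.\<close>
    moreover have "multidegree I ?d (X (Inr i) * X (Inl j) :: (nat + nat, 'k) mpol)"
      using multidegree_mult[OF multidegree_X(2) multidegree_X(1)] that by blast
    then have "multidegree I ?d (X (Inl j) * X (Inr i) :: (nat + nat, 'k) mpol)"
      by (simp only: mult.commute)
    ultimately have "multidegree I ?d (X (Inl i) * X (Inr j) - X (Inl j) * X (Inr i) :: (nat + nat, 'k) mpol)"
      by (rule multidegree_diff)
    then show ?thesis by blast
  qed
  obtain d where "multidegree I d (\<Prod>i\<in>I. X (Inl i) * X (Inr i) :: (nat + nat, 'k) mpol)"
    using multidegree_prod[of I I "\<lambda>i. X (Inl i) * X (Inr i) :: (nat + nat, 'k) mpol"] 1 by blast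
  moreover have "\<exists>d'. multidegree I d' (\<Prod>(i, j)\<in>{(i, j)\<in>I \<times> I. i \<noteq> j}.
      X (Inl i) * X (Inr j) - X (Inl j) * X (Inr i) :: (nat + nat, 'k) mpol)"
  proof (rule multidegree_prod)
    fix x assume "x \<in> {(i, j)\<in>I \<times> I. i \<noteq> j}"
    then obtain i j where "x = (i, j)" "i \<in> I" "j \<in> I" by blast
    then show "\<exists>d. multidegree I d (case x of (i, j) \<Rightarrow>
        (X (Inl i) * X (Inr j) - X (Inl j) * X (Inr i) :: (nat + nat, 'k) mpol))"
      using 2[of i j] by simp
  qed
  then obtain d' where "multidegree I d' (\<Prod>(i, j)\<in>{(i, j)\<in>I \<times> I. i \<noteq> j}.
      X (Inl i) * X (Inr j) - X (Inl j) * X (Inr i) :: (nat + nat, 'k) mpol)" by blast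
  ultimately show ?thesis
    unfolding genericity_form_def by (blast intro: multihomogeneousI multidegree_mult)
qed

lemma eval_genericity_form:
  fixes x :: "nat \<Rightarrow> 'k::field \<times> 'k"
  assumes "finite I"
  shows "eval_mpol (genericity_form I) (case_sum (\<lambda>i. fst (x i)) (\<lambda>i. snd (x i))) \<noteq> 0 \<longleftrightarrow>
    (\<forall>i\<in>I. fst (x i) \<noteq> 0 \<and> snd (x i) \<noteq> 0) \<and>
    (\<forall>i\<in>I. \<forall>j\<in>I. i \<noteq> j \<longrightarrow> fst (x i) * snd (x j) \<noteq> fst (x j) * snd (x i))"
proof -
  have "finite {(i, j)\<in>I \<times> I. i \<noteq> j}"
    by (rule finite_subset[of _ "I \<times> I"]) (use assms in auto)
  then show ?thesis
    using assms by (auto simp: eval_mpol_eq_subst genericity_form_def eval.subst_mult eval.subst_prod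
        eval_diff case_prod_unfold)
qed

definition generic_points :: "nat set \<Rightarrow> (nat \<Rightarrow> ('k::field \<times> 'k) set) set" where
  "generic_points I = (I \<rightarrow>\<^sub>E P1) - zero_locus I {genericity_form I}"

lemma zariski_open_generic_points: "zariski_open I (generic_points I)"
  unfolding zariski_open_def generic_points_def using multihomogeneous_genericity_form by blast

text \<open>The points [i;1] serve: in characteristic 0 they are distinct for distinct
  \<open>i\<close>, and their coordinates are non-zero since 0 is not an index.\<close>

lemma generic_points_nonempty:
  fixes I :: "nat set"
  assumes "finite I" "0 \<notin> I"
  shows "(generic_points I :: (nat \<Rightarrow> ('k::field_char_0 \<times> 'k) set) set) \<noteq> {}"
proof -
  have nz: "i \<noteq> 0" if "i \<in> I" for i using assms(2) that by metis
  define P where "P = (\<lambda>i\<in>I. proj_pt (of_nat i :: 'k) 1)"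
  define x where "x = (\<lambda>i. (of_nat i :: 'k, 1 :: 'k))"
  have "proj_pt c 1 \<in> P1" for c :: 'k
    unfolding P1_def by (intro CollectI exI[of _ c] exI[of _ 1]) simp
  then have "P \<in> I \<rightarrow>\<^sub>E P1" unfolding P_def by auto
  moreover have "x i \<in> P i" if "i \<in> I" for i
    using that by (auto simp: P_def x_def proj_pt_def intro!: exI[of _ 1])
  moreover have "eval_mpol (genericity_form I) (case_sum (\<lambda>i. fst (x i)) (\<lambda>i. snd (x i))) \<noteq> 0"
    unfolding eval_genericity_form[OF assms(1)] using nz by (simp add: x_def)
  ultimately have "P \<in> generic_points I" unfolding generic_points_def zero_locus_def by blast
  then show ?thesis by blast
qed

text \<open>Lying outside the zero locus only yields some system of representatives at which the
  form does not vanish. It differs from the given coordinates by one factor for each point, and the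
  three conditions survive this rescaling.\<close>

lemma generic_pointsD:
  fixes a b :: "nat \<Rightarrow> 'k::field"
  assumes "finite I" "(\<lambda>i\<in>I. proj_pt (a i) (b i)) \<in> generic_points I"
  shows "\<And>i. i \<in> I \<Longrightarrow> a i \<noteq> 0" "\<And>i. i \<in> I \<Longrightarrow> b i \<noteq> 0"
    and "\<And>i j. i \<in> I \<Longrightarrow> j \<in> I \<Longrightarrow> i \<noteq> j \<Longrightarrow> a i * b j \<noteq> a j * b i"
proof -
  from assms(2) obtain x where x: "\<forall>i\<in>I. x i \<in> proj_pt (a i) (b i)"
    and nz: "eval_mpol (genericity_form I) (case_sum (\<lambda>i. fst (x i)) (\<lambda>i. snd (x i))) \<noteq> 0"
    unfolding generic_points_def zero_locus_def by auto
  from x have "\<forall>i\<in>I. \<exists>s. x i = (s * a i, s * b i)" by (auto simp: proj_pt_def)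
  then obtain s where s: "\<forall>i\<in>I. x i = (s i * a i, s i * b i)" by metis
  note nz' = nz[unfolded eval_genericity_form[OF assms(1)]]
  show "a i \<noteq> 0" "b i \<noteq> 0" if "i \<in> I" for i using nz' s that by auto
  show "a i * b j \<noteq> a j * b i" if ij: "i \<in> I" "j \<in> I" "i \<noteq> j" for i j
  proof
    assume eq: "a i * b j = a j * b i"
    have "s i * a i * (s j * b j) = s i * s j * (a i * b j)" by (simp add: mult_ac)
    also have "\<dots> = s j * a j * (s i * b i)" by (simp add: eq mult_ac)
    finally show False using nz' s ij by auto
  qed
qed

text \<open>Supplies the enumeration that sends the position of the exceptional exponent to the
  parameter m + 1.\<close>

lemma ex_bij_betw_with_value:
  assumes "finite A" "card A = card B" "x \<in> A" "y \<in> B" "finite B"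
  shows "\<exists>f. bij_betw f A B \<and> f x = y"
proof -
  have "card (A - {x}) = card (B - {y})" using assms by simp
  then obtain f where "bij_betw f (A - {x}) (B - {y})"
    using assms by (metis finite_Diff finite_same_card_bij)
  then have "bij_betw (f(x := y)) (A - {x}) (B - {y})" by (subst bij_betw_cong[of _ _ f]) auto
  then have "bij_betw (f(x := y)) ((A - {x}) \<union> {x}) ((B - {y}) \<union> {(f(x := y)) x})"
    by (intro notIn_Un_bij_betw) auto
  then show ?thesis using assms by (intro exI[of _ "f(x := y)"]) (simp add: insert_absorb)
qed

theorem corollary6p18:
  fixes n r m :: nat
    and F1 F2 :: "(nat, 'k::field_char_0) mpol"
  assumes "n \<ge> 1" and "r \<ge> 1" and "m \<le> n - 1"
    and F1: "F1 = f1 n r m" and F2: "F2 = f2 n r m"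
  shows
    "(is_reduced_of (F1 * F2) (f12_red n r m) \<and>
      (\<forall>g. is_reduced_of (F1 * F2) g \<longrightarrow>
         free_with_exponents n g (1 # replicate (n - 1) (r + 1)))) \<and>
     (\<forall>k\<ge>3. \<exists>U. zariski_open {3..k} U \<and> U \<noteq> {} \<and>
        (\<forall>a b :: nat \<Rightarrow> 'k. (\<lambda>i\<in>{3..k}. proj_pt (a i) (b i)) \<in> U \<longrightarrow>
           inj_on (\<lambda>i. proj_pt (a i) (b i)) {3..k} \<and>
           (\<forall>i\<in>{3..k}. a i \<noteq> 0 \<and> b i \<noteq> 0) \<and>
           (\<forall>g. is_reduced_of (F1 * F2) g \<longrightarrow>
              free_with_exponents n (g * (\<Prod>i=3..k. cst (a i) * F1 + cst (b i) * F2))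
                (replicate (n - 1) (r + 1) @ [r * n * (k - 2) + 1]))))"
proof (intro conjI allI impI)
  have m: "m < n" using assms by simp
  \<comment> \<open>With no members chosen \<Lambda> is the empty product 1, so the exponent of
    \<open>H\<close> becomes 1.\<close>
  interpret pencil n r m "{}" "\<lambda>_. 0 :: 'k" "\<lambda>_. 0"
    using m assms(2) by unfold_locales auto
  show "is_reduced_of (F1 * F2) (f12_red n r m)"
    using is_reduced_of_f12_red by (simp add: F1 F2 F1_def F2_def)
  fix g assume g: "is_reduced_of (F1 * F2) g"
  \<comment> \<open>The exponent 1 of \<open>H\<close> heads the list.\<close>
  obtain \<pi> where \<pi>: "bij_betw \<pi> {..<n} {1..n}" "\<pi> 0 = m + 1"
    using ex_bij_betw_with_value[of "{..<n}" "{1..n}" 0 "m + 1"] m by auto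
  have "\<pi> j = m + 1 \<longleftrightarrow> j = 0" if "j < n" for j
    using \<pi> that m by (metis bij_betw_def inj_on_eq_iff lessThan_iff not_less_zero neq0_conv)
  then have "free_with_exponents n (g * (\<Prod>i\<in>({} :: nat set). cst 0 * f1 n r m + cst 0 * f2 n r m))
      (1 # replicate (n - 1) (r + 1))"
    using g m by (intro free_with_exponents_reduced[OF \<pi>(1)]) (auto simp: F1 F2 nth_Cons split: nat.splits)
  then show "free_with_exponents n g (1 # replicate (n - 1) (r + 1))" by simp
next
  fix k :: nat assume k: "k \<ge> 3"
  have m: "m < n" using assms by simp
  let ?U = "generic_points {3..k} :: (nat \<Rightarrow> ('k \<times> 'k) set) set"
  show "\<exists>U. zariski_open {3..k} U \<and> U \<noteq> {} \<and>
      (\<forall>a b :: nat \<Rightarrow> 'k. (\<lambda>i\<in>{3..k}. proj_pt (a i) (b i)) \<in> U \<longrightarrow>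
         inj_on (\<lambda>i. proj_pt (a i) (b i)) {3..k} \<and>
         (\<forall>i\<in>{3..k}. a i \<noteq> 0 \<and> b i \<noteq> 0) \<and>
         (\<forall>g. is_reduced_of (F1 * F2) g \<longrightarrow>
            free_with_exponents n (g * (\<Prod>i=3..k. cst (a i) * F1 + cst (b i) * F2))
              (replicate (n - 1) (r + 1) @ [r * n * (k - 2) + 1])))"
  proof (rule exI[of _ ?U], intro conjI allI impI)
    show "zariski_open {3..k} ?U" by (rule zariski_open_generic_points)
    show "?U \<noteq> {}" by (rule generic_points_nonempty) auto
    fix a b :: "nat \<Rightarrow> 'k" assume "(\<lambda>i\<in>{3..k}. proj_pt (a i) (b i)) \<in> ?U"
    note ab = generic_pointsD[OF _ this]
    show "\<forall>i\<in>{3..k}. a i \<noteq> 0 \<and> b i \<noteq> 0" using ab(1,2) by blast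
    show "inj_on (\<lambda>i. proj_pt (a i) (b i)) {3..k}"
    proof (rule inj_onI, rule ccontr)
      fix i j assume ij: "i \<in> {3..k}" "j \<in> {3..k}" "proj_pt (a i) (b i) = proj_pt (a j) (b j)" "i \<noteq> j"
      \<comment> \<open>Equal points have proportional coordinates, which makes their determinant
        vanish.\<close>
      have "(a i, b i) \<in> proj_pt (a i) (b i)" by (auto simp: proj_pt_def intro!: exI[of _ 1])
      then obtain s where "a i = s * a j" "b i = s * b j" unfolding ij(3) by (auto simp: proj_pt_def)
      then show False using ab(3)[OF _ ij(1,2,4)] by (simp add: mult_ac)
    qed
    interpret pencil n r m "{3..k}" a b
      using m assms(2) ab by unfold_locales auto
    fix g assume g: "is_reduced_of (F1 * F2) g"
    \<comment> \<open>Here the exponent of \<open>H\<close> comes last; its factor k - 2 is the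
      number of elements of \<open>{3..k}\<close>.\<close>
    obtain \<pi> where \<pi>: "bij_betw \<pi> {..<n} {1..n}" "\<pi> (n - 1) = m + 1"
      using ex_bij_betw_with_value[of "{..<n}" "{1..n}" "n - 1" "m + 1"] m by auto
    have "\<pi> j = m + 1 \<longleftrightarrow> j = n - 1" if "j < n" for j
      using \<pi> that m by (metis bij_betw_def diff_less gr_implies_not0 inj_on_eq_iff lessThan_iff neq0_conv zero_less_one)
    then show "free_with_exponents n (g * (\<Prod>i=3..k. cst (a i) * F1 + cst (b i) * F2))
        (replicate (n - 1) (r + 1) @ [r * n * (k - 2) + 1])"
      unfolding F1 F2 using g m k
      by (intro free_with_exponents_reduced[OF \<pi>(1)]) (auto simp: F1 F2 nth_append)
  qed
qed

end
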